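(* For every integer $k\ge 3$, the $k$-total cut complex of the squared cycle graph $W_{3k+2}$ is homotopy equivalent to the $5$-sphere: $\Delta_k^t(W_{3k+2})\simeq \mathbb{S}^5$.
   Context: The squared cycle graph $W_n$ is the graph with vertex set $[n]=\{1,\dots,n\}$ and edge set $\{\{i,i+1 \bmod n\},\{i,i+2 \bmod n\} : i=1,\dots,n\}$. For a graph $G=(V,E)$ and $k\ge 1$, the $k$-total cut complex $\Delta_k^t(G)$ is the simplicial complex on $V$ whose facets are the complements $V\setminus S$ of independent sets $S$ of $G$ with $|S|=k$; equivalently, $\sigma\subseteq V$ is a face iff $V\setminus\sigma$ contains an independent set of size $k$. *)

theory Defs
  imports "HOL-Analysis.Analysis"
begin

text \<open>Adjacency of the squared cycle graph W_n on vertex set {1..n}: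
  i ~ j iff j = i+1 (mod n) or j = i+2 (mod n) (or vice versa), with
  residues represented in {1..n} via i mod n + 1 (successor) and
  (i+1) mod n + 1 (second successor).\<close>
definition sq_cycle_adj :: "nat \<Rightarrow> nat \<Rightarrow> nat \<Rightarrow> bool" where
  "sq_cycle_adj n i j \<longleftrightarrow> i \<in> {1..n} \<and> j \<in> {1..n} \<and> i \<noteq> j \<and>
     (j = i mod n + 1 \<or> i = j mod n + 1 \<or>
      j = (i + 1) mod n + 1 \<or> i = (j + 1) mod n + 1)"

definition independent_set :: "'a set \<Rightarrow> ('a \<Rightarrow> 'a \<Rightarrow> bool) \<Rightarrow> 'a set \<Rightarrow> bool" where
  "independent_set V adj S \<longleftrightarrow> S \<subseteq> V \<and> (\<forall>i\<in>S. \<forall>j\<in>S. \<not> adj i j)"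

definition total_cut_complex :: "'a set \<Rightarrow> ('a \<Rightarrow> 'a \<Rightarrow> bool) \<Rightarrow> nat \<Rightarrow> 'a set set" where
  "total_cut_complex V adj k =
     {\<sigma>. \<sigma> \<subseteq> V \<and> (\<exists>S. S \<subseteq> V - \<sigma> \<and> card S = k \<and> independent_set V adj S)}"

text \<open>Geometric realization of a simplicial complex Delta on a finite vertex set
  V \<subseteq> nat, as a subspace of R^nat (product topology): points with nonnegative
  barycentric coordinates indexed by V, summing to 1, whose support is a face.\<close>
definition geom_realization :: "nat set \<Rightarrow> nat set set \<Rightarrow> (nat \<Rightarrow> real) topology" where
  "geom_realization V \<Delta> = subtopology (powertop_real UNIV)
     {x. (\<forall>i. 0 \<le> x i) \<and> (\<forall>i. i \<notin> V \<longrightarrow> x i = 0) \<and> sum x V = 1 \<and>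
         {i. x i \<noteq> 0} \<in> \<Delta>}"

end

theory Submission
  imports Defs
begin

text \<open>
  Since \<open>3 (k + 1) = 1\<close> modulo \<open>n = 3 k + 2\<close>, multiplying the vertices by \<open>k + 1\<close> turns the complement of
  an independent \<open>k\<close>-set of \<open>W\<^sub>n\<close> into a union of two arcs of \<open>k + 1\<close> consecutive residues, so the
  complex consists of the sets covered by two such arcs. For a general system \<open>{x..e x}\<close> of arcs,
  shortening a single arc removes a family of faces that splits into finitely many layers, each
  closed under adding and deleting a fixed vertex; hence the homotopy type does not change, as long
  as three arcs never cover the circle and four arcs always do. Two systems that both embed into
  a common larger one therefore give the same homotopy type. This compares \<open>3 k + 2\<close> points and arcs
  of \<open>k + 1\<close> points with \<open>7\<close> points and arcs of \<open>3\<close> points (via \<open>3 k + 5\<close> points and arcs of \<open>k + 2\<close>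
  points), and the latter complex is the boundary of the \<open>6\<close>-simplex.
\<close>

section \<open>Deformations of geometric realizations\<close>

text \<open>For uniform arcs \<open>{i..i + l}\<close> on \<open>n\<close> points, a passage between
  two systems goes from the larger ratio of \<open>l\<close> to \<open>n\<close> down to the smaller
  one. A direct comparison of \<open>3 k + 2\<close> points with \<open>7\<close> would need
  \<open>2 / 7 \<le> k / (3 k + 2)\<close>, which fails at \<open>k = 3\<close>. The ratio
  \<open>(k + 1) / (3 k + 5)\<close> is at least both \<open>k / (3 k + 2)\<close> and
  \<open>2 / 7\<close> for every \<open>k \<ge> 3\<close>, hence the detour. The hypothesis on
  \<open>k\<close> also enters through \<open>3 k + 2 < 4 k\<close>, the requirement that four arcs
  go round. The opposite bound is tight in the common system:
  \<open>3 (k + 1) + 1 < 3 k + 5\<close>. The faces lost by shortening one arc have no common apex,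
  because the vertex that can be toggled freely depends on what obstructs a cover by the remaining
  arcs. This forces the layers.\<close>

definition realize :: "'a set \<Rightarrow> 'a set set \<Rightarrow> ('a \<Rightarrow> real) set" where
  "realize V K = {x. (\<forall>i. 0 \<le> x i) \<and> (\<forall>i. i \<notin> V \<longrightarrow> x i = 0) \<and> sum x V = 1 \<and> {i. x i \<noteq> 0} \<in> K}"

lemma geom_realization_eq: "geom_realization V K = top_of_set (realize V K)"
  by (simp add: geom_realization_def realize_def euclidean_product_topology)

lemma realize_subset_vertices:
  assumes "finite V" "T \<subseteq> V" "\<And>s. s \<in> K \<Longrightarrow> s \<subseteq> T"
  shows "realize V K = realize T K"
proof -
  have "sum x V = sum x T" if "\<forall>i. i \<notin> T \<longrightarrow> x i = 0" for x :: "'a \<Rightarrow> real"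
    using assms that by (intro sum.mono_neutral_right) auto
  moreover have "\<forall>i. i \<notin> T \<longrightarrow> x i = 0" if "{i. x i \<noteq> 0} \<in> K" for x :: "'a \<Rightarrow> real"
    using assms(3)[OF that] by auto
  ultimately show ?thesis
    using assms(2) unfolding realize_def by (smt (verit, best) Collect_cong subsetD)
qed

lemma continuous_on_eval:
  fixes f :: "'b::topological_space \<Rightarrow> 'a \<Rightarrow> real"
  assumes "continuous_on S f" shows "continuous_on S (\<lambda>x. f x i)"
  using assms by (rule continuous_on_product_then_coordinatewise)

text \<open>The straight-line homotopy from the identity to \<open>f\<close> works, since the
  segment from \<open>x\<close> to \<open>f x\<close> stays in the simplex spanned by both supports.
  The carrier condition is asked for \<open>L\<close> too because \<open>f\<close> need not fix
  \<open>realize V L\<close> pointwise.\<close>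

lemma realize_retract_homotopy_eqv:
  fixes f :: "('a \<Rightarrow> real) \<Rightarrow> ('a \<Rightarrow> real)"
  assumes fin: "finite V" and LK: "L \<subseteq> K"
    and downK: "\<And>s t. s \<in> K \<Longrightarrow> t \<subseteq> s \<Longrightarrow> t \<in> K"
    and downL: "\<And>s t. s \<in> L \<Longrightarrow> t \<subseteq> s \<Longrightarrow> t \<in> L"
    and cont: "continuous_on (realize V K) f"
    and into: "f ` realize V K \<subseteq> realize V L"
    and carK: "\<And>x. x \<in> realize V K \<Longrightarrow> {i. x i \<noteq> 0} \<union> {i. f x i \<noteq> 0} \<in> K"
    and carL: "\<And>x. x \<in> realize V L \<Longrightarrow> {i. x i \<noteq> 0} \<union> {i. f x i \<noteq> 0} \<in> L"
  shows "realize V K homotopy_eqv realize V L"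
proof -
  define h where "h = (\<lambda>(t::real, x) i. (1 - t) * x i + t * f x i)"
  have sub: "realize V L \<subseteq> realize V K"
    using LK by (auto simp: realize_def)
  have hin: "h (t, x) \<in> realize V M"
    if M: "\<And>s t. s \<in> M \<Longrightarrow> t \<subseteq> s \<Longrightarrow> t \<in> M" and t: "t \<in> {0..1}" and x: "x \<in> realize V K"
      and c: "{i. x i \<noteq> 0} \<union> {i. f x i \<noteq> 0} \<in> M" for M t x
  proof -
    have fx: "f x \<in> realize V L" using into x by blast
    have "sum (h (t, x)) V = (1 - t) * sum x V + t * sum (f x) V"
      by (simp add: h_def sum.distrib sum_distrib_left)
    then have "sum (h (t, x)) V = 1"
      using x fx by (simp add: realize_def)
    moreover have "{i. h (t, x) i \<noteq> 0} \<in> M"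
      by (rule M[OF c]) (auto simp: h_def)
    moreover have "0 \<le> h (t, x) i" for i
      using t x fx by (simp add: realize_def h_def)
    moreover have "i \<notin> V \<Longrightarrow> h (t, x) i = 0" for i
      using x fx by (simp add: realize_def h_def)
    ultimately show ?thesis by (auto simp: realize_def)
  qed
  have hc: "continuous_on ({0..1} \<times> realize V K) h"
    unfolding h_def case_prod_beta
  proof (intro continuous_on_coordinatewise_then_product continuous_intros)
    fix i
    show "continuous_on ({0..1} \<times> realize V K) (\<lambda>p. snd p i)"
      by (rule continuous_on_eval) (intro continuous_intros)
    have "continuous_on ({0..1} \<times> realize V K) (\<lambda>p. f (snd p))"
      by (rule continuous_on_compose2[OF cont]) (auto intro: continuous_intros)
    then show "continuous_on ({0..1} \<times> realize V K) (\<lambda>p. f (snd p) i)"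
      by (rule continuous_on_eval)
  qed
  have hom: "homotopic_with_canon (\<lambda>_. True) (realize V M) (realize V M) id f"
    if M: "\<And>s t. s \<in> M \<Longrightarrow> t \<subseteq> s \<Longrightarrow> t \<in> M" and MK: "M \<subseteq> K"
      and c: "\<And>x. x \<in> realize V M \<Longrightarrow> {i. x i \<noteq> 0} \<union> {i. f x i \<noteq> 0} \<in> M" for M
  proof -
    have "realize V M \<subseteq> realize V K" using MK by (auto simp: realize_def)
    then have "continuous_on ({0..1} \<times> realize V M) h" "h ` ({0..1} \<times> realize V M) \<subseteq> realize V M"
      using continuous_on_subset[OF hc, of "{0..1} \<times> realize V M"] hin[OF M] c by auto
    then show ?thesis
      unfolding homotopic_with_def
      by (intro exI[of _ h]) (auto simp: h_def prod_topology_subtopology_eu image_subset_iff_funcset)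
  qed
  have cf: "continuous_map (top_of_set (realize V K)) (top_of_set (realize V L)) f"
    using cont into by auto
  have cid: "continuous_map (top_of_set (realize V L)) (top_of_set (realize V K)) id"
    using sub by auto
  show ?thesis
    unfolding homotopy_equivalent_space_def
    using cf cid hom[OF downK order.refl carK] hom[OF downL LK carL]
    by (intro exI[of _ f] exI[of _ id]) (simp add: homotopic_with_symD)
qed

text \<open>Mass is pushed forward along the fibres of \<open>f\<close>. Condition
  \<open>dom\<close> says that the induced simplicial map is contiguous to the identity.\<close>

lemma simplicial_retract_homotopy_eqv:
  fixes f :: "'a \<Rightarrow> 'a"
  assumes fin: "finite V" and T: "T \<subseteq> V" "f ` V \<subseteq> T" "\<And>v. v \<in> T \<Longrightarrow> f v = v"
    and KV: "\<And>s. s \<in> K \<Longrightarrow> s \<subseteq> V"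
    and down: "\<And>s t. s \<in> K \<Longrightarrow> t \<subseteq> s \<Longrightarrow> t \<in> K"
    and dom: "\<And>s. s \<in> K \<Longrightarrow> s \<union> f ` s \<in> K"
  shows "realize V K homotopy_eqv realize T {s \<in> K. s \<subseteq> T}"
proof -
  let ?L = "{s \<in> K. s \<subseteq> T}"
  define F :: "('a \<Rightarrow> real) \<Rightarrow> 'a \<Rightarrow> real" where "F = (\<lambda>x i. \<Sum>v\<in>{v\<in>V. f v = i}. x v)"
  have supp: "{i. F x i \<noteq> 0} = f ` {i. x i \<noteq> 0}" if x: "x \<in> realize V K" for x
  proof -
    have "F x i \<noteq> 0 \<longleftrightarrow> (\<exists>v\<in>{v\<in>V. f v = i}. x v \<noteq> 0)" for i
      unfolding F_def using x fin by (subst sum_nonneg_eq_0_iff) (auto simp: realize_def)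
    then show ?thesis using x by (auto simp: realize_def)
  qed
  have "realize V K homotopy_eqv realize V ?L"
  proof (rule realize_retract_homotopy_eqv[of V _ _ F])
    show "continuous_on (realize V K) F"
      unfolding F_def
      by (intro continuous_on_coordinatewise_then_product continuous_on_sum)
         (rule continuous_on_eval[OF continuous_on_id])
    show "F ` realize V K \<subseteq> realize V ?L"
    proof clarify
      fix x assume x: "x \<in> realize V K"
      then have s: "{i. x i \<noteq> 0} \<in> K" by (simp add: realize_def)
      then have "f ` {i. x i \<noteq> 0} \<in> K" using dom down by (meson Un_upper2)
      moreover have "f ` {i. x i \<noteq> 0} \<subseteq> T" using KV[OF s] T by auto
      moreover have "sum (F x) V = sum x V"
        unfolding F_def using fin T by (subst sum.group) auto
      moreover have "0 \<le> F x i" for i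
        unfolding F_def using x by (intro sum_nonneg) (auto simp: realize_def)
      moreover have "F x i = 0" if "i \<notin> V" for i
      proof -
        have "{v\<in>V. f v = i} = {}" using T that by auto
        then show ?thesis unfolding F_def by (metis sum.empty)
      qed
      ultimately show "F x \<in> realize V ?L"
        using x supp[OF x] by (auto simp: realize_def)
    qed
    fix x assume x: "x \<in> realize V K"
    then show "{i. x i \<noteq> 0} \<union> {i. F x i \<noteq> 0} \<in> K"
      using dom supp[OF x] by (simp add: realize_def)
  next
    fix x assume x: "x \<in> realize V ?L"
    then have xK: "x \<in> realize V K" by (auto simp: realize_def)
    have "f ` {i. x i \<noteq> 0} = {i. x i \<noteq> 0}"
      using x T(3) by (force simp: realize_def)
    then show "{i. x i \<noteq> 0} \<union> {i. F x i \<noteq> 0} \<in> ?L"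
      using supp[OF xK] x by (simp add: realize_def)
  qed (use fin down in \<open>auto dest: subset_trans\<close>)
  moreover have "realize V ?L = realize T ?L"
    using fin T by (intro realize_subset_vertices) auto
  ultimately show ?thesis by simp
qed

lemma continuous_on_Min_coords:
  assumes "finite A" "A \<noteq> {}"
  shows "continuous_on S (\<lambda>x::'a \<Rightarrow> real. Min (x ` A))"
  using assms
proof (induction A rule: finite_ne_induct)
  case (singleton a)
  then show ?case by (simp add: continuous_on_eval[OF continuous_on_id])
next
  case (insert a A)
  then have "Min (x ` insert a A) = min (x a) (Min (x ` A))" for x :: "'a \<Rightarrow> real" by simp
  then show ?case
    using insert by (simp only:) (intro continuous_on_min continuous_on_eval[OF continuous_on_id])
qed

text \<open>Pushing the common mass of \<open>t\<close> to the apex \<open>w\<close> empties the open star of \<open>t\<close>.\<close>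
lemma star_removal_homotopy_eqv:
  assumes fin: "finite V" and t: "t \<subseteq> V" "t \<noteq> {}" and w: "w \<in> V" "w \<notin> t"
    and KV: "\<And>s. s \<in> K \<Longrightarrow> s \<subseteq> V"
    and down: "\<And>s t. s \<in> K \<Longrightarrow> t \<subseteq> s \<Longrightarrow> t \<in> K"
    and cone: "\<And>s. s \<in> K \<Longrightarrow> t \<subseteq> s \<Longrightarrow> insert w s \<in> K"
  shows "realize V K homotopy_eqv realize V {s \<in> K. \<not> t \<subseteq> s}"
proof -
  let ?L = "{s \<in> K. \<not> t \<subseteq> s}"
  have fint: "finite t" using fin t finite_subset by blast
  define \<mu> where "\<mu> = (\<lambda>x::'a \<Rightarrow> real. Min (x ` t))"
  \<comment> \<open>Subtracting the minimum keeps all coordinates nonnegative and makes at least one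
    vertex of \<open>t\<close> vanish. Outside the open star the minimum is \<open>0\<close> and
    nothing moves.\<close>
  define F where "F = (\<lambda>x i. x i + (if i \<in> t then - \<mu> x else 0)
                          + (if i = w then real (card t) * \<mu> x else 0))"
  have mu_le: "\<mu> x \<le> x i" if "i \<in> t" for x i
    unfolding \<mu>_def using fint that by auto
  have mu_in: "\<exists>i\<in>t. \<mu> x = x i" for x
  proof -
    have "\<mu> x \<in> x ` t" unfolding \<mu>_def using fint t by (intro Min_in) auto
    then show ?thesis by auto
  qed
  have mu_ge: "0 \<le> \<mu> x" if "x \<in> realize V M" for x M
    using mu_in[of x] that by (auto simp: realize_def)
  have mu0: "\<mu> x = 0" if x: "x \<in> realize V M" "\<not> t \<subseteq> {i. x i \<noteq> 0}" for x M
  proof -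
    from x(2) obtain i where "i \<in> t" "x i = 0" by auto
    then show ?thesis using mu_le[of i x] mu_ge[OF x(1)] by simp
  qed
  have F0: "F x = x" if "\<mu> x = 0" for x
    using that by (auto simp: F_def)
  have supp: "{i. x i \<noteq> 0} \<union> {i. F x i \<noteq> 0} \<in> K" if x: "x \<in> realize V K" for x
  proof (cases "t \<subseteq> {i. x i \<noteq> 0}")
    case True
    have "{i. F x i \<noteq> 0} \<subseteq> insert w {i. x i \<noteq> 0}"
      using True by (auto simp: F_def split: if_splits)
    then show ?thesis
      using True cone[of "{i. x i \<noteq> 0}"] x by (auto simp: realize_def intro: down)
  next
    case False
    then show ?thesis using F0[OF mu0[OF x False]] x by (simp add: realize_def)
  qed
  show ?thesis
  proof (rule realize_retract_homotopy_eqv[of V _ _ F])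
    have "continuous_on (realize V K) (\<lambda>x. x i + (if i \<in> t then - \<mu> x else 0)
                          + (if i = w then real (card t) * \<mu> x else 0))" for i
      unfolding \<mu>_def
      by (cases "i \<in> t"; cases "i = w")
         (auto intro!: continuous_intros continuous_on_eval[OF continuous_on_id] continuous_on_Min_coords fint t(2))
    then show "continuous_on (realize V K) F"
      unfolding F_def by (intro continuous_on_coordinatewise_then_product) simp
    show "F ` realize V K \<subseteq> realize V ?L"
    proof clarify
      fix x assume x: "x \<in> realize V K"
      have "sum (F x) V = sum x V + (\<Sum>i\<in>V. if i \<in> t then - \<mu> x else 0)
              + (\<Sum>i\<in>V. if i = w then real (card t) * \<mu> x else 0)"
        by (simp add: F_def sum.distrib)
      also have "(\<Sum>i\<in>V. if i \<in> t then - \<mu> x else 0) = - (real (card t) * \<mu> x)"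
        using fin t(1) by (simp add: sum.If_cases Int_absorb1)
      also have "(\<Sum>i\<in>V. if i = w then real (card t) * \<mu> x else 0) = real (card t) * \<mu> x"
        using fin w by simp
      finally have "sum (F x) V = 1" using x by (simp add: realize_def)
      moreover have "0 \<le> F x i" for i
        using x mu_ge[OF x] mu_le[of i x] by (auto simp: F_def realize_def)
      moreover have "i \<notin> V \<Longrightarrow> F x i = 0" for i
        using x t w by (auto simp: F_def realize_def)
      moreover have "{i. F x i \<noteq> 0} \<in> K"
        using supp[OF x] by (rule down) auto
      moreover have "\<not> t \<subseteq> {i. F x i \<noteq> 0}"
      proof -
        obtain i where "i \<in> t" "\<mu> x = x i" using mu_in by blast
        then have "F x i = 0" using w by (auto simp: F_def)
        with \<open>i \<in> t\<close> show ?thesis by auto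
      qed
      ultimately show "F x \<in> realize V ?L" by (simp add: realize_def)
    qed
    fix x assume "x \<in> realize V K"
    then show "{i. x i \<noteq> 0} \<union> {i. F x i \<noteq> 0} \<in> K" by (rule supp)
  next
    fix x assume x: "x \<in> realize V ?L"
    then have "F x = x" by (intro F0 mu0[OF x]) (auto simp: realize_def)
    then show "{i. x i \<noteq> 0} \<union> {i. F x i \<noteq> 0} \<in> ?L" using x by (simp add: realize_def)
  qed (use fin down in \<open>auto dest: subset_trans\<close>)
qed

text \<open>A minimal \<open>t\<close> in \<open>K - L\<close> omits \<open>w\<close>, since
  otherwise \<open>t - {w}\<close> would be a smaller one. All faces above \<open>t\<close> are
  outside \<open>L\<close>, so its star is a cone with apex \<open>w\<close> and can be emptied. The
  hypotheses survive: as \<open>w\<close> is not in \<open>t\<close>, inserting \<open>w\<close>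
  never makes a face contain \<open>t\<close>.\<close>

lemma cone_removal_homotopy_eqv:
  assumes fin: "finite V" and w: "w \<in> V" and LK: "L \<subseteq> K" and L0: "{} \<in> L"
    and KV: "\<And>s. s \<in> K \<Longrightarrow> s \<subseteq> V"
    and downK: "\<And>s t. s \<in> K \<Longrightarrow> t \<subseteq> s \<Longrightarrow> t \<in> K"
    and downL: "\<And>s t. s \<in> L \<Longrightarrow> t \<subseteq> s \<Longrightarrow> t \<in> L"
    and ins: "\<And>s. s \<in> K - L \<Longrightarrow> insert w s \<in> K"
    and del: "\<And>s. s \<in> K - L \<Longrightarrow> s - {w} \<notin> L"
  shows "realize V K homotopy_eqv realize V L"
  using LK KV downK ins del
proof (induction "card (K - L)" arbitrary: K rule: less_induct)
  case less
  have finK: "finite K"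
    using less.prems(2) fin by (meson finite_Pow_iff PowI finite_subset subsetI)
  show ?case
  proof (cases "K = L")
    case True
    then show ?thesis by (simp add: homotopy_equivalent_space_refl)
  next
    case False
    then have ne: "K - L \<noteq> {}" using less.prems(1) by auto
    obtain t where t: "t \<in> K - L" and tmin: "\<And>s. s \<in> K - L \<Longrightarrow> s \<subseteq> t \<Longrightarrow> s = t"
      using finite_has_minimal[of "K - L"] ne finK by (metis finite_Diff)
    have wt: "w \<notin> t"
    proof
      assume "w \<in> t"
      moreover have "t - {w} \<in> K - L" using t less.prems(3,5) by blast
      ultimately show False using tmin[of "t - {w}"] by blast
    qed
    let ?K' = "{s \<in> K. \<not> t \<subseteq> s}"
    have LK': "L \<subseteq> ?K'" using less.prems(1) downL t by blast
    have "realize V K homotopy_eqv realize V ?K'"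
    proof (rule star_removal_homotopy_eqv[of V t w])
      show "insert w s \<in> K" if "s \<in> K" "t \<subseteq> s" for s
        using that t downL less.prems(4) by blast
      show "t \<noteq> {}" using t L0 by auto
    qed (use fin t less.prems wt w in auto)
    moreover have "realize V ?K' homotopy_eqv realize V L"
    proof (rule less.hyps)
      have "?K' - L \<subset> K - L" using t by blast
      then show "card (?K' - L) < card (K - L)"
        using finK by (intro psubset_card_mono) auto
      show "insert w s \<in> ?K'" if "s \<in> ?K' - L" for s
        using that less.prems(4) wt by blast
    qed (use LK' less.prems in auto)
    ultimately show ?thesis by (rule homotopy_eqv_trans)
  qed
qed

text \<open>By \<open>mono\<close> larger faces have smaller levels, so discarding levels in
  increasing order leaves a subcomplex each time. Within one level the apex is constant and
  \<open>cone_removal_homotopy_eqv\<close> applies.\<close>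

lemma graded_cone_removal_homotopy_eqv:
  fixes lev :: "'a set \<Rightarrow> nat" and apex :: "nat \<Rightarrow> 'a"
  assumes fin: "finite V" and LK: "L \<subseteq> K" and L0: "{} \<in> L"
    and KV: "\<And>s. s \<in> K \<Longrightarrow> s \<subseteq> V"
    and downK: "\<And>s t. s \<in> K \<Longrightarrow> t \<subseteq> s \<Longrightarrow> t \<in> K"
    and downL: "\<And>s t. s \<in> L \<Longrightarrow> t \<subseteq> s \<Longrightarrow> t \<in> L"
    and mono: "\<And>s t. s \<in> K - L \<Longrightarrow> t \<in> K - L \<Longrightarrow> t \<subseteq> s \<Longrightarrow> lev s \<le> lev t"
    and bound: "\<And>s. s \<in> K - L \<Longrightarrow> lev s < N"
    and apex: "\<And>s. s \<in> K - L \<Longrightarrow> apex (lev s) \<in> V"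
    and ins: "\<And>s. s \<in> K - L \<Longrightarrow> insert (apex (lev s)) s \<in> K - L \<and> lev (insert (apex (lev s)) s) = lev s"
    and del: "\<And>s. s \<in> K - L \<Longrightarrow> s - {apex (lev s)} \<in> K - L \<and> lev (s - {apex (lev s)}) = lev s"
  shows "realize V K homotopy_eqv realize V L"
proof -
  define M where "M = (\<lambda>j. L \<union> {s \<in> K - L. j \<le> lev s})"
  have M: "M j \<subseteq> K" "s \<in> M j \<Longrightarrow> t \<subseteq> s \<Longrightarrow> t \<in> M j" for j s t
  proof -
    show "M j \<subseteq> K" using LK by (auto simp: M_def)
    assume a: "s \<in> M j" "t \<subseteq> s"
    show "t \<in> M j"
    proof (cases "t \<in> L")
      case False
      then have "s \<in> K - L" "t \<in> K - L" using a downL downK LK unfolding M_def by blast+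
      then show ?thesis using a mono[of s t] by (auto simp: M_def)
    qed (simp add: M_def)
  qed
  have step: "realize V (M j) homotopy_eqv realize V (M (Suc j))" for j
  proof (cases "\<exists>s\<in>K - L. lev s = j")
    case True
    have D: "s \<in> M j - M (Suc j) \<longleftrightarrow> s \<in> K - L \<and> lev s = j" for s
      by (auto simp: M_def)
    show ?thesis
    proof (rule cone_removal_homotopy_eqv[of V "apex j"])
      show "insert (apex j) s \<in> M j" if "s \<in> M j - M (Suc j)" for s
        using that ins[of s] unfolding D by (auto simp: M_def)
      show "s - {apex j} \<notin> M (Suc j)" if "s \<in> M j - M (Suc j)" for s
        using that del[of s] unfolding D by (auto simp: M_def)
      show "apex j \<in> V" using True apex by blast
      show "M (Suc j) \<subseteq> M j" by (auto simp: M_def)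
      show "{} \<in> M (Suc j)" using L0 by (simp add: M_def)
      show "s \<subseteq> V" if "s \<in> M j" for s using that M(1) KV by blast
    qed (use fin M(2) in blast)+
  next
    case False
    then have "j \<le> lev s \<longleftrightarrow> Suc j \<le> lev s" if "s \<in> K - L" for s
      using that by (metis Suc_leD Suc_leI le_neq_implies_less)
    then have "M j = M (Suc j)" unfolding M_def by blast
    then show ?thesis by (simp add: homotopy_equivalent_space_refl)
  qed
  have "realize V (M 0) homotopy_eqv realize V (M j)" for j
  proof (induction j)
    case (Suc j)
    then show ?case using step homotopy_eqv_trans by blast
  qed (simp add: homotopy_equivalent_space_refl)
  moreover have "M 0 = K" using LK by (auto simp: M_def)
  moreover have "M N = L" using bound by (fastforce simp: M_def)
  ultimately show ?thesis by metis
qed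

lemma relabel_homotopy_eqv:
  fixes g :: "'a \<Rightarrow> 'b"
  assumes bij: "bij_betw g V W" and KV: "\<And>s. s \<in> K \<Longrightarrow> s \<subseteq> V" and LW: "\<And>s. s \<in> L \<Longrightarrow> s \<subseteq> W"
    and iff: "\<And>s. s \<subseteq> V \<Longrightarrow> g ` s \<in> L \<longleftrightarrow> s \<in> K"
  shows "realize V K homotopy_eqv realize W L"
proof -
  define h where "h = inv_into V g"
  have gh: "h (g i) = i" if "i \<in> V" for i
    using that bij by (simp add: h_def bij_betw_inv_into_left)
  have hg: "g (h j) = j" "h j \<in> V" if "j \<in> W" for j
    using that bij by (simp_all add: h_def bij_betw_inv_into_right bij_betw_apply[OF bij_betw_inv_into])
  have gV: "g i \<in> W" if "i \<in> V" for i using that bij by (auto simp: bij_betw_def)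
  define F where "F = (\<lambda>(x::'a \<Rightarrow> real) j. if j \<in> W then x (h j) else 0)"
  define G where "G = (\<lambda>(y::'b \<Rightarrow> real) i. if i \<in> V then y (g i) else 0)"
  have F: "F x \<in> realize W L" if x: "x \<in> realize V K" for x
  proof -
    have "sum (F x) W = sum x V"
      by (rule sum.reindex_bij_witness[of _ g h]) (auto simp: F_def gh hg gV)
    moreover have "{j. F x j \<noteq> 0} = g ` {i. x i \<noteq> 0}"
    proof (intro equalityI subsetI)
      fix j assume "j \<in> {j. F x j \<noteq> 0}"
      then have "j \<in> W" "x (h j) \<noteq> 0" by (auto simp: F_def split: if_splits)
      then show "j \<in> g ` {i. x i \<noteq> 0}" using hg(1)[of j] by (intro image_eqI[of _ _ "h j"]) auto
    next
      fix j assume "j \<in> g ` {i. x i \<noteq> 0}"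
      then obtain i where "j = g i" "x i \<noteq> 0" by auto
      moreover from this x have "i \<in> V" by (auto simp: realize_def)
      ultimately show "j \<in> {j. F x j \<noteq> 0}" by (simp add: F_def gV gh)
    qed
    ultimately show ?thesis using x iff[of "{i. x i \<noteq> 0}"] KV
      by (auto simp: realize_def F_def)
  qed
  have G: "G y \<in> realize V K" if y: "y \<in> realize W L" for y
  proof -
    have "sum (G y) V = sum y W"
      by (rule sum.reindex_bij_witness[of _ h g]) (auto simp: G_def gh hg gV)
    moreover have "{i. G y i \<noteq> 0} \<subseteq> V" by (auto simp: G_def)
    moreover have "g ` {i. G y i \<noteq> 0} = {j. y j \<noteq> 0}"
    proof (intro equalityI subsetI)
      fix j assume "j \<in> {j. y j \<noteq> 0}"
      then have "j \<in> W" "y j \<noteq> 0" using y by (auto simp: realize_def)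
      then show "j \<in> g ` {i. G y i \<noteq> 0}"
        using hg[of j] by (intro image_eqI[of _ _ "h j"]) (auto simp: G_def)
    qed (auto simp: G_def split: if_splits)
    ultimately show ?thesis using y iff[of "{i. G y i \<noteq> 0}"]
      by (auto simp: realize_def G_def)
  qed
  have "homeomorphism (realize V K) (realize W L) F G"
  proof (rule homeomorphismI)
    have "continuous_on (realize V K) (\<lambda>x. if j \<in> W then x (h j) else 0)" for j
      by (cases "j \<in> W") (auto intro: continuous_on_eval[OF continuous_on_id])
    then show "continuous_on (realize V K) F"
      unfolding F_def by (intro continuous_on_coordinatewise_then_product) simp
    have "continuous_on (realize W L) (\<lambda>x. if j \<in> V then x (g j) else 0)" for j
      by (cases "j \<in> V") (auto intro: continuous_on_eval[OF continuous_on_id])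
    then show "continuous_on (realize W L) G"
      unfolding G_def by (intro continuous_on_coordinatewise_then_product) simp
    show "G (F x) = x" if "x \<in> realize V K" for x
      using that gh gV by (auto simp: F_def G_def realize_def fun_eq_iff)
    show "F (G y) = y" if "y \<in> realize W L" for y
      using that hg by (auto simp: F_def G_def realize_def fun_eq_iff)
  qed (use F G in auto)
  then have "realize V K homeomorphic realize W L"
    unfolding homeomorphic_def by blast
  then show ?thesis by (rule homeomorphic_imp_homotopy_eqv)
qed

section \<open>Shortening an arc\<close>

text \<open>The circle of \<open>n\<close> points is unrolled to the integers, which turns cyclic
  order into linear order: \<open>e\<close> is the lift of the map taking the start of an arc to its
  end.\<close>

locale arc_system =
  fixes n :: int and e :: "int \<Rightarrow> int"
  assumes n_pos: "0 < n" and mono_e: "mono e"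
    and e_period: "e (i + n) = e i + n" and le_e: "i \<le> e i"
begin

lemma e_mono: "i \<le> j \<Longrightarrow> e i \<le> e j"
  using mono_e by (rule monoD)

lemma e_period_nat: "e (i + int k * n) = e i + int k * n"
proof (induction k)
  case (Suc k)
  have "i + int (Suc k) * n = (i + int k * n) + n" by (simp add: algebra_simps)
  then show ?case using Suc e_period[of "i + int k * n"] by (simp add: add.assoc)
qed simp

lemma e_shift: "e (i + k * n) = e i + k * n"
proof (cases "0 \<le> k")
  case True
  then show ?thesis using e_period_nat[of i "nat k"] by simp
next
  case False
  then show ?thesis using e_period_nat[of "i + k * n" "nat (- k)"] by simp
qed

lemma e_minus: "e (i - n) = e i - n"
  using e_shift[of i "-1"] by simp

text \<open>Periodicity makes \<open>e\<close> small far to the left, so by monotonicity the starts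
  whose arcs reach \<open>j\<close> form an up-set with a least element.\<close>

lemma ex_lower_adjoint: "\<exists>c. \<forall>i. j \<le> e i \<longleftrightarrow> c \<le> i"
proof -
  define i0 where "i0 = - (\<bar>e 0\<bar> + \<bar>j\<bar> + 1) * n"
  have "(\<bar>e 0\<bar> + \<bar>j\<bar> + 1) * 1 \<le> (\<bar>e 0\<bar> + \<bar>j\<bar> + 1) * n"
    using n_pos by (intro mult_left_mono) auto
  then have i0: "e i0 < j"
    using e_shift[of 0 "- (\<bar>e 0\<bar> + \<bar>j\<bar> + 1)"] unfolding i0_def mult_minus_left add_0_left mult_1_right
    by linarith
  define P where "P = (\<lambda>k::nat. j \<le> e (i0 + int k))"
  have "i0 < j" using i0 le_e[of i0] by simp
  then have "P (nat (j - i0))" using le_e[of j] by (simp add: P_def)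
  then have P: "P (Least P)" by (rule LeastI)
  show ?thesis
  proof (intro exI allI iffI)
    fix i assume "j \<le> e i"
    moreover have "i0 \<le> i" using i0 e_mono[of i i0] \<open>j \<le> e i\<close> by linarith
    ultimately have "P (nat (i - i0))" by (simp add: P_def)
    then have "Least P \<le> nat (i - i0)" by (rule Least_le)
    then show "i0 + int (Least P) \<le> i" using \<open>i0 \<le> i\<close> by linarith
  next
    fix i assume "i0 + int (Least P) \<le> i"
    then show "j \<le> e i" using P e_mono[of "i0 + int (Least P)" i] by (simp add: P_def)
  qed
qed

end

section \<open>Sets covered by two arcs of a circle\<close>

definition arc_complex :: "int \<Rightarrow> (int \<Rightarrow> int) \<Rightarrow> int \<Rightarrow> int set set" where
  "arc_complex n e c =
     {s. s \<subseteq> {c..<c + n} \<and> (\<exists>x y. \<forall>v\<in>s. \<exists>k. v + k * n \<in> {x..e x} \<union> {y..e y})}"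

definition arc_space :: "int \<Rightarrow> (int \<Rightarrow> int) \<Rightarrow> int \<Rightarrow> (int \<Rightarrow> real) set" where
  "arc_space n e c = realize {c..<c + n} (arc_complex n e c)"

lemma arc_complex_down: "s \<in> arc_complex n e c \<Longrightarrow> t \<subseteq> s \<Longrightarrow> t \<in> arc_complex n e c"
  unfolding arc_complex_def by blast

lemma arc_complexI:
  assumes "s \<subseteq> {c..<c + n}" "\<And>v. v \<in> s \<Longrightarrow> \<exists>k. v + k * n \<in> {x..e x} \<union> {y..e y}"
  shows "s \<in> arc_complex n e c"
  using assms unfolding arc_complex_def by blast

text \<open>The choice of window is immaterial. This allows each shortening step to use a window
  adapted to its own arc.\<close>

lemma arc_space_rotate:
  assumes "0 < n"
  shows "arc_space n e c homotopy_eqv arc_space n e d"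
  unfolding arc_space_def
proof (rule relabel_homotopy_eqv[where g = "\<lambda>v. d + (v - d) mod n"])
  have mod_mod: "c + (d + (v - d) mod n - c) mod n = v" if "v \<in> {c..<c + n}" for v c d :: int
  proof -
    have "(d + (v - d) mod n - c) mod n = ((d - c) + (v - d)) mod n"
      by (metis add_diff_eq diff_add_eq mod_add_right_eq add.commute)
    then show ?thesis using that by simp
  qed
  show "bij_betw (\<lambda>v. d + (v - d) mod n) {c..<c + n} {d..<d + n}"
    by (rule bij_betw_byWitness[of _ "\<lambda>v. c + (v - c) mod n"])
       (use assms in \<open>auto simp: mod_mod\<close>)
  fix s assume s: "s \<subseteq> {c..<c + n}"
  have *: "(\<exists>k. d + (v - d) mod n + k * n \<in> A) \<longleftrightarrow> (\<exists>k. v + k * n \<in> A)" for v A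
  proof -
    have v: "d + (v - d) mod n = v - (v - d) div n * n"
      by (simp add: minus_div_mult_eq_mod[symmetric])
    show ?thesis
    proof
      assume "\<exists>k. d + (v - d) mod n + k * n \<in> A"
      then obtain k where "v + (k - (v - d) div n) * n \<in> A" by (auto simp: v algebra_simps)
      then show "\<exists>k. v + k * n \<in> A" by blast
    next
      assume "\<exists>k. v + k * n \<in> A"
      then obtain k where "v + k * n \<in> A" by blast
      then have "d + (v - d) mod n + (k + (v - d) div n) * n \<in> A" by (simp add: v algebra_simps)
      then show "\<exists>k. d + (v - d) mod n + k * n \<in> A" by blast
    qed
  qed
  have "(\<lambda>v. d + (v - d) mod n) ` s \<subseteq> {d..<d + n}" using assms by auto
  then show "(\<lambda>v. d + (v - d) mod n) ` s \<in> arc_complex n e d \<longleftrightarrow> s \<in> arc_complex n e c"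
    using s unfolding arc_complex_def by (simp add: * del: Un_iff)
qed (auto simp: arc_complex_def)

text \<open>Passing from \<open>e\<close> to \<open>e'\<close> removes the single maximal arc \<open>{a..e a}\<close>. The hypotheses say
  that three arcs never cover the circle, and that four arcs always do, in a strong sense.\<close>

locale arc_removal = arc_system n e + small: arc_system n e' for n e e' +
  fixes a :: int
  assumes e'_a: "e' a = e a - 1" and e'_other: "\<not> n dvd i - a \<Longrightarrow> e' i = e i"
    and three: "e (e (e i) + 1) < i + n" and four: "i + n < e' (e' (e' (e' i)))"
begin

section \<open>Landmarks around the shortened arc\<close>

definition "b = e a"
text \<open>The first start whose arc reaches \<open>a\<close>; \<open>d\<close> below is the first
  one whose arc goes beyond \<open>a\<close>. With \<open>c\<close> as left end of the window, arcs
  that contain \<open>a\<close> or \<open>b\<close> can be placed inside the window without wrapping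
  round.\<close>

definition "c = (SOME c. \<forall>i. a \<le> e i \<longleftrightarrow> c \<le> i)"
definition "d = (SOME d. \<forall>i. a + 1 \<le> e i \<longleftrightarrow> d \<le> i)"

lemma c_iff: "a \<le> e i \<longleftrightarrow> c \<le> i"
  using someI_ex[OF ex_lower_adjoint[of a]] unfolding c_def by blast

lemma d_iff: "a + 1 \<le> e i \<longleftrightarrow> d \<le> i"
  using someI_ex[OF ex_lower_adjoint[of "a + 1"]] unfolding d_def by blast

lemma n_gt1: "1 < n"
proof -
  have "i + 1 \<le> e (e (e i) + 1)" for i
    using le_e[of i] le_e[of "e i"] le_e[of "e (e i) + 1"] by linarith
  then show ?thesis using three[of 0] by (smt (verit))
qed

lemma e'_le: "e' i \<le> e i"
proof (cases "n dvd i - a")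
  case True
  then obtain k where "i - a = n * k" by (rule dvdE)
  then have "i = a + k * n" by (simp add: algebra_simps)
  then show ?thesis using e_shift[of a k] small.e_shift[of a k] e'_a by simp
qed (simp add: e'_other)

lemma e'_le_e: "i \<le> j \<Longrightarrow> e' i \<le> e j"
  using e'_le[of i] e_mono[of i j] by linarith

lemma e'_near: "a < i \<Longrightarrow> i < a + n \<Longrightarrow> e' i = e i" "a - n < i \<Longrightarrow> i < a \<Longrightarrow> e' i = e i"
  using zdvd_not_zless[of "i - a" n] zdvd_not_zless[of "a - i" n] dvd_diff_commute[of n i a]
    e'_other[of i] by linarith+

lemma e_before_a: "i < a \<Longrightarrow> e i < b"
proof -
  assume "i < a"
  have "e (a - 1) = e' (a - 1)" using e'_near(2)[of "a - 1"] n_gt1 by simp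
  also have "\<dots> \<le> e' a" by (rule small.e_mono) simp
  finally show ?thesis using e'_a e_mono[of i "a - 1"] \<open>i < a\<close> by (simp add: b_def)
qed

lemma ee_a: "e b + 1 < a + n"
  using three[of a] le_e[of "e b + 1"] unfolding b_def by linarith

text \<open>Successive arcs from \<open>c\<close> reach \<open>a\<close>, then \<open>b\<close>,
  then \<open>e b\<close>, and three arcs do not go round.\<close>

lemma e_b: "e b < c + n"
proof -
  have "e b \<le> e (e (e c) + 1)"
    using c_iff[of c] by (intro e_mono) (use e_mono[of a "e c"] in \<open>simp add: b_def\<close>)
  then show ?thesis using three[of c] by linarith
qed

lemma c_le_a: "c \<le> a" using c_iff[of a] le_e[of a] by simp

lemma c_le_d: "c \<le> d" using c_iff[of d] d_iff[of d] by simp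

text \<open>The first of four shortened arcs from \<open>a\<close> is the shortened one itself,
  which ends at \<open>b - 1\<close>; this is why \<open>b - 1\<close> rather than \<open>b\<close>
  appears.\<close>

lemma e'3: "a + n < e (e (e (b - 1)))"
proof -
  have "e' (e' (e' (e' a))) \<le> e (e (e (b - 1)))"
    using e'_a by (intro e'_le_e) (simp add: b_def)
  then show ?thesis using four[of a] by linarith
qed

lemma b_lt_e: "b < e (b - 1)"
proof (rule ccontr)
  assume "\<not> ?thesis"
  then have "e (e (e (b - 1))) \<le> e (e b)" by (intro e_mono) simp
  also have "\<dots> \<le> e (e b + 1)" by (intro e_mono) simp
  finally show False using e'3 three[of a] by (simp add: b_def)
qed

lemma a_lt_b: "a + 1 < b"
proof (rule ccontr)
  assume "\<not> ?thesis"
  then have "e (b - 1) \<le> e a" by (intro e_mono) simp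
  then show False using b_lt_e by (simp add: b_def)
qed

lemma d_lt_a: "d < a"
proof (rule ccontr)
  assume "\<not> ?thesis"
  then have *: "e (a - 1) \<le> a" using d_iff[of "a - 1"] by simp
  have "e' (e' (e' (e' (a - 1)))) \<le> e (e (e (e (a - 1))))"
    by (intro e'_le_e) simp
  also have "\<dots> \<le> e (e (e a))" using * by (intro e_mono)
  also have "\<dots> \<le> e (e (e a) + 1)" by (intro e_mono) simp
  finally show False using four[of "a - 1"] three[of a] by simp
qed

lemma d_le: "d + n \<le> e (e (b - 1))"
  using e'3 d_iff[of "e (e (b - 1)) - n"] by (simp add: e_minus)

section \<open>Characterisation of the lost faces\<close>

abbreviation "K \<equiv> arc_complex n e c"
abbreviation "L \<equiv> arc_complex n e' c"

text \<open>A face is lost when the arc \<open>{a..b}\<close> is shortened iff the rest \<open>R s\<close> of it, unrolled into the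
  window between \<open>b\<close> and \<open>a + n\<close>, fits into one arc, and either some point lies beyond both
  arcs that start at \<open>b\<close> and end at \<open>a\<close>, or a chain of three points blocks
  every way of splitting \<open>s\<close> between an arc through \<open>a\<close> and another one through \<open>b\<close>.\<close>

definition "R s = {r. b < r \<and> r < a + n \<and> (r \<in> s \<or> r - n \<in> s)}"
definition "valid s \<longleftrightarrow> (\<forall>r\<in>R s. \<forall>r'\<in>R s. r' \<le> e r)"
definition "chain s h w q \<longleftrightarrow> h \<in> s \<and> w \<in> s \<and> q \<in> s \<and> h < a \<and> w < b \<and> b < q \<and> e h < w \<and> e w < q"
definition "lost s \<longleftrightarrow> a \<in> s \<and> b \<in> s \<and> valid s \<and> ((\<exists>p\<in>s. e b < p) \<or> (\<exists>h w q. chain s h w q))"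

lemma K_subset: "s \<in> K \<Longrightarrow> s \<subseteq> {c..<c + n}"
  by (simp add: arc_complex_def)

lemma L_subset_K: "L \<subseteq> K"
proof
  fix s assume "s \<in> L"
  then obtain x y where s: "s \<subseteq> {c..<c + n}" and xy: "\<And>v. v \<in> s \<Longrightarrow> \<exists>k. v + k * n \<in> {x..e' x} \<union> {y..e' y}"
    unfolding arc_complex_def by blast
  have "{x..e' x} \<union> {y..e' y} \<subseteq> {x..e x} \<union> {y..e y}"
    using e'_le[of x] e'_le[of y] by auto
  then show "s \<in> K" using xy by (intro arc_complexI[OF s]) blast
qed

lemma shift_0: "v \<in> {c..<c + n} \<Longrightarrow> v + k * n \<in> {c..<c + n} \<Longrightarrow> k = 0"
proof -
  assume "v \<in> {c..<c + n}" "v + k * n \<in> {c..<c + n}"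
  then have "\<bar>k * n\<bar> < n" by auto
  then show "k = 0" using n_pos by (simp add: abs_mult)
qed

lemma e'_b: "e' b = e b"
  using e'_near(1)[of b] a_lt_b ee_a le_e[of b] by simp

text \<open>If no covering arc were a translate of \<open>{a..b}\<close>, both would survive the
  shortening. If both were, the face would lie in \<open>{a..b}\<close>, which the shortened arc and
  the arc from \<open>b\<close> still cover.\<close>

lemma lost_cover:
  assumes "s \<in> K" "s \<notin> L"
  obtains y where "\<not> n dvd y - a" "\<And>v. v \<in> s \<Longrightarrow> v \<in> {a..b} \<or> (\<exists>k. v + k * n \<in> {y..e y})"
proof -
  obtain x y where s: "s \<subseteq> {c..<c + n}" and xy: "\<And>v. v \<in> s \<Longrightarrow> \<exists>k. v + k * n \<in> {x..e x} \<union> {y..e y}"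
    using assms unfolding arc_complex_def by blast
  have *: "v \<in> {a..b}" if "n dvd z - a" "v + k * n \<in> {z..e z}" "v \<in> s" for z v k
  proof -
    have "\<exists>j. z - a = n * j" using that(1) unfolding dvd_def .
    then obtain j where "z - a = n * j" by blast
    then have z: "z = a + j * n" by (simp add: algebra_simps)
    have "v + (k - j) * n \<in> {a..b}"
      using that(2) by (auto simp: z e_shift b_def algebra_simps)
    moreover from this have "v + (k - j) * n \<in> {c..<c + n}"
      using c_le_a e_b le_e[of b] by auto
    ultimately show ?thesis using shift_0[of v "k - j"] s that(3) by auto
  qed
  have AL: "\<not> (\<forall>v\<in>s. v \<in> {a..b})"
  proof
    assume ab: "\<forall>v\<in>s. v \<in> {a..b}"
    have "\<exists>k. v + k * n \<in> {a..e' a} \<union> {b..e' b}" if "v \<in> s" for v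
      using ab that e'_a[folded b_def] le_e[of b] by (intro exI[of _ 0]) (auto simp: e'_b)
    then show False using assms(2) arc_complexI[OF s] by blast
  qed
  consider "n dvd x - a" "n dvd y - a" | "n dvd x - a" "\<not> n dvd y - a"
    | "\<not> n dvd x - a" "n dvd y - a" | "\<not> n dvd x - a" "\<not> n dvd y - a" by blast
  then show ?thesis
  proof cases
    case 1
    then show ?thesis using AL * xy by blast
  next
    case 2
    then show ?thesis using that[of y] * xy by blast
  next
    case 3
    then show ?thesis using that[of x] * xy by blast
  next
    case 4
    then have "s \<in> L" using s xy by (intro arc_complexI[of _ _ _ x e' y]) (auto simp: e'_other)
    then show ?thesis using assms(2) by blast
  qed
qed

lemma R_bounds: "s \<subseteq> {c..<c + n} \<Longrightarrow> r \<in> R s \<Longrightarrow> b < r \<and> r < a + n"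
  by (auto simp: R_def)

lemma not_face_imp_lost:
  assumes "s \<in> K" "s \<notin> L"
  shows "lost s"
proof -
  have s: "s \<subseteq> {c..<c + n}" using assms K_subset by blast
  obtain y where y: "\<not> n dvd y - a" "\<And>v. v \<in> s \<Longrightarrow> v \<in> {a..b} \<or> (\<exists>k. v + k * n \<in> {y..e y})"
    using lost_cover[OF assms] by blast
  have notL: False if "\<And>v. v \<in> s \<Longrightarrow> \<exists>k. v + k * n \<in> {x..e' x} \<union> {z..e' z}" for x z
    using that arc_complexI[OF s] assms(2) by blast
  have a_in: "a \<in> s"
  proof (rule ccontr)
    assume "a \<notin> s"
    have "\<exists>k. v + k * n \<in> {a + 1..e' (a + 1)} \<union> {y..e' y}" if "v \<in> s" for v
    proof (cases "v \<in> {a..b}")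
      case True
      moreover have "b \<le> e (a + 1)" unfolding b_def by (intro e_mono) simp
      moreover have "v \<noteq> a" using \<open>a \<notin> s\<close> that by blast
      ultimately show ?thesis using n_gt1 by (intro exI[of _ 0]) (auto simp: e'_near)
    qed (use y(2)[OF that] e'_other[OF y(1)] in auto)
    then show False by (rule notL)
  qed
  have b_in: "b \<in> s"
  proof (rule ccontr)
    assume "b \<notin> s"
    have "\<exists>k. v + k * n \<in> {a..e' a} \<union> {y..e' y}" if "v \<in> s" for v
    proof (cases "v \<in> {a..b}")
      case True
      moreover have "v \<noteq> b" using \<open>b \<notin> s\<close> that by blast
      ultimately show ?thesis using e'_a by (intro exI[of _ 0]) (auto simp: b_def)
    qed (use y(2)[OF that] e'_other[OF y(1)] in auto)
    then show False by (rule notL)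
  qed
  have Rcov: "\<exists>k. r + k * n \<in> {y..e y}" if r: "r \<in> R s" for r
  proof (cases "r \<in> s")
    case True
    then show ?thesis using y(2)[OF True] r by (auto simp: R_def)
  next
    case False
    then have "r - n \<in> s" "r - n \<notin> {a..b}" using r by (auto simp: R_def)
    then obtain k where "r - n + k * n \<in> {y..e y}" using y(2) by blast
    then have "r + (k - 1) * n \<in> {y..e y}" by (simp add: algebra_simps)
    then show ?thesis by blast
  qed
  \<comment> \<open>An arc meeting two different translates of the stretch between \<open>b\<close>
    and \<open>a + n\<close> would start before a translate of \<open>a\<close> and pass the
    matching translate of \<open>b\<close>, but arcs starting before \<open>a\<close> end before
    \<open>b\<close>.\<close>
  have apart: False if "r \<in> R s" "r' \<in> R s" "k < k'" "r + k * n \<in> {y..e y}" "r' + k' * n \<in> {y..e y}" for r r' k k'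
  proof -
    have "y \<le> a - 1 + (k + 1) * n" using that R_bounds[OF s that(1)] by (auto simp: algebra_simps)
    then have "e y \<le> e (a - 1) + (k + 1) * n" using e_mono e_shift by metis
    moreover have "b + (k + 1) * n \<le> b + k' * n" using that(3) n_pos by simp
    moreover have "b < r'" using R_bounds[OF s that(2)] by simp
    ultimately show False using e_before_a[of "a - 1"] that(5) by auto
  qed
  have valid: "valid s"
    unfolding valid_def
  proof (intro ballI)
    fix r r' assume r: "r \<in> R s" "r' \<in> R s"
    then obtain k k' where k: "r + k * n \<in> {y..e y}" "r' + k' * n \<in> {y..e y}" using Rcov by blast
    then have "\<not> k < k'" "\<not> k' < k" using apart r by blast+
    then have "k = k'" by simp
    moreover have "e y \<le> e r + k * n" using k e_mono[of y "r + k * n"] by (simp add: e_shift)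
    ultimately show "r' \<le> e r" using k by auto
  qed
  have "\<exists>h w q. chain s h w q" if P: "\<not> (\<exists>p\<in>s. e b < p)"
  proof (rule ccontr)
    assume nc: "\<not> ?thesis"
    \<comment> \<open>A greedy cover: the first arc starts at the first point of \<open>s\<close>,
      the second at the first point that the first arc misses. If a point \<open>v\<close> stays
      uncovered, either \<open>w = b\<close> and \<open>v\<close> lies beyond \<open>e b\<close>, or
      \<open>x\<close>, \<open>w\<close>, \<open>v\<close> form a chain.\<close>
    define x where "x = Min (s \<inter> {c..a})"
    have fin: "finite (s \<inter> {c..a})" "s \<inter> {c..a} \<noteq> {}" using a_in c_le_a by auto
    then have x: "x \<in> s" "c \<le> x" "x \<le> a"
      using Min_in[OF fin] unfolding x_def by auto
    have x_le: "x \<le> h" if "h \<in> s" "h \<le> a" for h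
      using that s unfolding x_def by (intro Min_le[OF fin(1)]) auto
    have e'x: "a \<le> e' x" "e' x < b"
    proof -
      show "e' x < b" using small.e_mono[OF x(3)] e'_a by (simp add: b_def)
      show "a \<le> e' x"
      proof (cases "x = a")
        case True
        then show ?thesis using e'_a a_lt_b by (simp add: b_def)
      next
        case False
        have "a - n < c" using e_b le_e[of b] a_lt_b by linarith
        then have "e' x = e x" using False x by (intro e'_near) auto
        then show ?thesis using x(2) c_iff by simp
      qed
    qed
    define w where "w = Min (s \<inter> {e' x<..b})"
    have fin: "finite (s \<inter> {e' x<..b})" "s \<inter> {e' x<..b} \<noteq> {}" using b_in e'x by auto
    then have w: "w \<in> s" "e' x < w" "w \<le> b"
      using Min_in[OF fin] unfolding w_def by auto
    have w_le: "w \<le> h" if "h \<in> s" "h \<le> b" "e' x < h" for h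
      using that unfolding w_def by (intro Min_le[OF fin(1)]) auto
    have e'w: "e' w = e w" using w e'x ee_a le_e[of b] by (intro e'_near) auto
    have "b \<le> e w" using e_mono[of a w] w e'x by (simp add: b_def)
    have "v \<in> {x..e' x} \<union> {w..e' w}" if v: "v \<in> s" for v
    proof -
      consider "v \<le> a" | "a < v" "v \<le> b" | "b < v" by linarith
      then show ?thesis
      proof cases
        case 1
        then show ?thesis using x_le[OF v] e'x by auto
      next
        case 2
        then show ?thesis
          using x(3) w_le[OF v] e'w \<open>b \<le> e w\<close> by (cases "v \<le> e' x") auto
      next
        case 3
        have "v \<le> e w"
        proof (cases "w = b")
          case True
          then show ?thesis using P v by (simp add: not_less)
        next
          case False
          then have "x < a" using w(2,3) x(3) e'_a by (auto simp: b_def less_le)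
          moreover have "a - n < c" using e_b le_e[of b] a_lt_b by linarith
          ultimately have "e' x = e x" using x by (intro e'_near) auto
          moreover have "w < b" using False w(3) by simp
          moreover have "\<not> chain s x w v" using nc by blast
          ultimately show ?thesis
            using x(1) w(1,2) v \<open>x < a\<close> 3 by (simp add: chain_def not_less)
        qed
        then show ?thesis using 3 w(3) e'w by auto
      qed
    qed
    then show False by (intro notL[of x w] exI[of _ 0]) auto
  qed
  then show ?thesis using a_in b_in valid by (auto simp: lost_def)
qed

lemma lost_imp_face:
  assumes s: "s \<subseteq> {c..<c + n}" and "lost s"
  shows "s \<in> K"
proof (cases "R s = {}")
  case True
  have "v \<in> {a..b}" if "v \<in> s" for v
  proof (rule ccontr)
    assume v: "v \<notin> {a..b}"
    have "v \<in> R s \<or> v + n \<in> R s"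
      using v that s e_b le_e[of b] c_le_a a_lt_b by (auto simp: R_def)
    then show False using True by blast
  qed
  then show ?thesis using s by (intro arc_complexI[of _ _ _ a e a] exI[of _ 0]) (auto simp: b_def)
next
  case False
  have "finite (R s)" by (rule finite_subset[of _ "{b..a + n}"]) (auto simp: R_def)
  define y where "y = Min (R s)"
  have y: "y \<in> R s" "\<And>r. r \<in> R s \<Longrightarrow> y \<le> r"
    using \<open>finite (R s)\<close> False by (auto simp: y_def)
  have val: "\<And>r. r \<in> R s \<Longrightarrow> r \<le> e y"
    using assms(2) y(1) by (auto simp: lost_def valid_def)
  show ?thesis
  proof (rule arc_complexI[OF s, of a e y])
    fix v assume v: "v \<in> s"
    consider "v \<in> {a..b}" | "v < a" | "b < v" by fastforce
    then show "\<exists>k. v + k * n \<in> {a..e a} \<union> {y..e y}"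
    proof cases
      case 1
      then show ?thesis by (intro exI[of _ 0]) (auto simp: b_def)
    next
      case 2
      then have "v + n \<in> R s" using v s e_b le_e[of b] by (auto simp: R_def)
      then show ?thesis using y(2) val by (intro exI[of _ 1]) auto
    next
      case 3
      then have "v \<in> R s" using v s c_le_a by (auto simp: R_def)
      then show ?thesis using y(2) val by (intro exI[of _ 0]) auto
    qed
  qed
qed

text \<open>No shortened arc contains both \<open>a\<close> and \<open>b\<close>: starting by
  \<open>a\<close> it ends before \<open>b\<close>, and starting by \<open>b\<close> it does not get
  round to \<open>a + n\<close>. So one arc takes \<open>a\<close>, the other takes
  \<open>b\<close>, and neither wraps in the window. A chain then defeats them: \<open>h\<close>
  forces the first arc to end before \<open>w\<close>, and \<open>w\<close> forces the second to end
  before \<open>q\<close>.\<close>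

lemma lost_imp_not_face:
  assumes "lost s"
  shows "s \<notin> L"
proof
  assume "s \<in> L"
  then obtain x0 y0 where s: "s \<subseteq> {c..<c + n}"
    and xy0: "\<And>v. v \<in> s \<Longrightarrow> \<exists>k. v + k * n \<in> {x0..e' x0} \<union> {y0..e' y0}"
    unfolding arc_complex_def by blast
  have not_both: "\<not> (a + k * n \<in> {z..e' z} \<and> b + j * n \<in> {z..e' z})" for z k j
  proof
    assume A: "a + k * n \<in> {z..e' z} \<and> b + j * n \<in> {z..e' z}"
    show False
    proof (cases "k \<le> j")
      case True
      then have "k * n \<le> j * n" using n_pos by simp
      moreover have "e' z \<le> e' a + k * n" using A small.e_mono[of z "a + k * n"] by (simp add: small.e_shift)
      ultimately show False using A e'_a by (auto simp: b_def)
    next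
      case False
      then have "(j + 1) * n \<le> k * n" using n_pos by (intro mult_right_mono) auto
      moreover have "e' z \<le> e b + j * n" using A e'_le_e[of z "b + j * n"] by (simp add: e_shift)
      ultimately show False using A ee_a by (auto simp: algebra_simps)
    qed
  qed
  have cov_shift: "\<exists>k. v + k * n \<in> {z - j * n..e' (z - j * n)}" if "v + i * n \<in> {z..e' z}" for v i j z
    using that small.e_shift[of z "- j"] by (intro exI[of _ "i - j"]) (auto simp: algebra_simps)
  have "\<exists>x y. x \<le> a \<and> a \<le> e' x \<and> y \<le> b \<and> b \<le> e' y \<and>
      (\<forall>v\<in>s. (\<exists>k. v + k * n \<in> {x..e' x}) \<or> (\<exists>k. v + k * n \<in> {y..e' y}))"
  proof -
    have ab: "a \<in> s" "b \<in> s" using assms by (auto simp: lost_def)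
    obtain i j where i: "a + i * n \<in> {x0..e' x0} \<union> {y0..e' y0}" and j: "b + j * n \<in> {x0..e' x0} \<union> {y0..e' y0}"
      using xy0 ab by blast
    have *: ?thesis
      if "a + i * n \<in> {x..e' x}" "b + j * n \<in> {y..e' y}"
        and cv: "\<And>v. v \<in> s \<Longrightarrow> \<exists>k. v + k * n \<in> {x..e' x} \<union> {y..e' y}" for x y
    proof (rule exI[of _ "x - i * n"], rule exI[of _ "y - j * n"], intro conjI ballI)
      show "x - i * n \<le> a" "y - j * n \<le> b" using that by auto
      show "a \<le> e' (x - i * n)" "b \<le> e' (y - j * n)"
        using that small.e_shift[of x "- i"] small.e_shift[of y "- j"] by auto
      fix v assume "v \<in> s"
      then obtain k where "v + k * n \<in> {x..e' x} \<or> v + k * n \<in> {y..e' y}" using cv by blast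
      then show "(\<exists>k. v + k * n \<in> {x - i * n..e' (x - i * n)}) \<or> (\<exists>k. v + k * n \<in> {y - j * n..e' (y - j * n)})"
        using cov_shift by blast
    qed
    show ?thesis
    proof (cases "a + i * n \<in> {x0..e' x0}")
      case True
      then show ?thesis using * not_both j xy0 by blast
    next
      case False
      then have "a + i * n \<in> {y0..e' y0}" using i by blast
      then show ?thesis using *[of y0 x0] not_both j xy0 by blast
    qed
  qed
  then obtain x y where xa: "x \<le> a" "a \<le> e' x" and yb: "y \<le> b" "b \<le> e' y"
    and cov: "\<And>v. v \<in> s \<Longrightarrow> (\<exists>k. v + k * n \<in> {x..e' x}) \<or> (\<exists>k. v + k * n \<in> {y..e' y})"
    by blast
  have x: "c \<le> x" "e' x < b"
    using xa e'_le[of x] c_iff[of x] small.e_mono[OF xa(1)] e'_a by (auto simp: b_def)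
  have y: "a < y" "e' y \<le> e b"
  proof -
    show "a < y" using not_both[of 0 y 0] yb a_lt_b by (rule_tac ccontr) auto
    show "e' y \<le> e b" using yb(1) by (rule e'_le_e)
  qed
  have cov: "v \<in> {x..e' x} \<or> v \<in> {y..e' y}" if v: "v \<in> s" for v
  proof -
    obtain k where k: "v + k * n \<in> {x..e' x} \<or> v + k * n \<in> {y..e' y}" using cov[OF v] by blast
    then have "v + k * n \<in> {c..<c + n}" using x y e_b le_e[of b] c_le_a by auto
    then have "k = 0" using shift_0 v s by blast
    then show ?thesis using k by simp
  qed
  consider p where "p \<in> s" "e b < p" | h w q where "chain s h w q"
    using assms unfolding lost_def by blast
  then show False
  proof cases
    case 1
    then show False using cov[OF 1(1)] x y le_e[of b] by auto
  next
    case 2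
    note ch = 2[unfolded chain_def]
    have "x \<le> h" using cov[of h] ch y by auto
    then have "e' x < w" using ch e'_le_e[of x h] by linarith
    then have "y \<le> w" using cov[of w] ch by auto
    then have "e' y < q" using ch e'_le_e[of y w] by linarith
    then show False using cov[of q] ch x by auto
  qed
qed

lemma lost_iff: "s \<in> K - L \<longleftrightarrow> s \<subseteq> {c..<c + n} \<and> lost s"
  using not_face_imp_lost lost_imp_face lost_imp_not_face K_subset by blast

text \<open>The layers of the lost faces are removed in this order. A face is full if every point strictly
  between \<open>a\<close> and \<open>b\<close> is the middle of a chain in it.\<close>

definition "full s \<longleftrightarrow> (\<exists>h\<in>s. h < a \<and> e h \<le> a) \<and> (\<exists>q\<in>s. e (b - 1) < q)"

definition level :: "int set \<Rightarrow> nat" where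
  "level s = (if \<exists>p\<in>s. e b < p then 0
     else if full s then
       (if \<exists>w\<in>s. a < w \<and> w < b - 1 then 1 else if \<exists>h\<in>s. h < a \<and> e (e (b - 1)) < h + n then 2 else 3)
     else if \<exists>q\<in>s. e (b - 1) < q then 4 else 5)"

text \<open>Each apex is a point whose presence cannot matter in its level. Level 0: the point
  beyond \<open>e b\<close> already obstructs, so any inner point of the arc will do. Level 1: every
  inner point of a full face is a chain middle, so \<open>b - 1\<close> is free beside another one.
  Levels 2 and 3: \<open>b - 1\<close> is the only inner point, so the apex is sought outside the
  arc, where \<open>d\<close> or \<open>e (b - 1)\<close> can be added while \<open>R\<close> still
  fits into one arc. Level 4: no \<open>h\<close> has \<open>e h \<le> a\<close>, so
  \<open>a + 1\<close> is never a middle. Level 5: no \<open>q\<close> exceeds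
  \<open>e (b - 1)\<close>, so \<open>b - 1\<close> is never a middle.\<close>

definition apex :: "nat \<Rightarrow> int" where
  "apex j = (if j = 0 \<or> j = 4 then a + 1 else if j = 1 \<or> j = 5 then b - 1 else if j = 2 then d else e (b - 1))"

lemma apex_in: "apex j \<in> {c..<c + n}"
  using c_le_a a_lt_b e_b le_e[of b] c_le_d d_lt_a b_lt_e e_mono[of "b - 1" b]
  by (auto simp: apex_def)

lemma level_mono:
  assumes "t \<subseteq> s"
  shows "level s \<le> level t"
proof -
  have "full t \<Longrightarrow> full s" using assms unfolding full_def by blast
  then show ?thesis using assms unfolding level_def by (simp; blast)
qed

section \<open>Toggling the apex of a layer\<close>

lemma lost_toggle_arc:
  assumes s: "lost s" and agree: "\<And>v. v \<noteq> z \<Longrightarrow> v \<in> s \<longleftrightarrow> v \<in> t" and z: "a < z" "z < b"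
    and ch: "(\<exists>p\<in>s. e b < p) \<or> (\<exists>h w q. chain s h w q \<and> w \<noteq> z)"
  shows "lost t"
proof -
  \<comment> \<open>Neither \<open>z\<close> nor \<open>z + n\<close> falls between \<open>b\<close>
    and \<open>a + n\<close>, so \<open>R\<close> does not see \<open>z\<close>. Its only possible
    role is as the middle of a chain.\<close>
  have zn: "z < b + n" "a < z + n" using z n_pos by auto
  then have "R t = R s" using agree z e_b le_e[of b] unfolding R_def by (intro Collect_cong) (smt (verit))
  moreover have "a \<in> t" "b \<in> t" using s agree z by (auto simp: lost_def)
  moreover have "(\<exists>p\<in>t. e b < p) \<or> (\<exists>h w q. chain t h w q)"
    using ch
  proof (elim disjE bexE exE conjE)
    fix p assume "p \<in> s" "e b < p"
    moreover from this have "p \<noteq> z" using z le_e[of b] by simp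
    ultimately show ?thesis using agree by blast
  next
    fix h w q assume "chain s h w q" "w \<noteq> z"
    moreover from this have "h \<noteq> z" "q \<noteq> z" using z by (auto simp: chain_def)
    ultimately have "chain t h w q" using agree by (auto simp: chain_def)
    then show ?thesis by blast
  qed
  ultimately show ?thesis using s by (auto simp: lost_def valid_def)
qed

lemma lost_remove:
  assumes s: "lost s" and z: "z \<noteq> a" "z \<noteq> b" "z \<in> {c..<c + n}"
    and ch: "\<exists>h w q. chain s h w q \<and> h \<noteq> z \<and> w \<noteq> z \<and> q \<noteq> z"
  shows "lost (s - {z})"
proof -
  have "R (s - {z}) \<subseteq> R s" by (auto simp: R_def)
  then have "valid (s - {z})" using s unfolding lost_def valid_def by blast
  moreover obtain h w q where "chain s h w q" "h \<noteq> z" "w \<noteq> z" "q \<noteq> z" using ch by blast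
  then have "chain (s - {z}) h w q" by (simp add: chain_def)
  ultimately show ?thesis using s z by (auto simp: lost_def)
qed

lemma lost_insert:
  assumes s: "lost s" and z: "\<And>z'. z' \<in> R (insert z s) - R s \<Longrightarrow> z' \<le> e z' \<and> (\<forall>r\<in>R s. r \<le> e z' \<and> z' \<le> e r)"
    and one: "\<And>z' z''. z' \<in> R (insert z s) - R s \<Longrightarrow> z'' \<in> R (insert z s) - R s \<Longrightarrow> z' = z''"
    and ch: "\<exists>h w q. chain s h w q"
  shows "lost (insert z s)"
proof -
  have "valid (insert z s)" unfolding valid_def
  proof (intro ballI)
    fix r r' assume r: "r \<in> R (insert z s)" "r' \<in> R (insert z s)"
    show "r' \<le> e r"
    proof (cases "r \<in> R s"; cases "r' \<in> R s")
      assume "r \<in> R s" "r' \<in> R s"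
      then show ?thesis using s by (auto simp: lost_def valid_def)
    next
      assume "r \<in> R s" "r' \<notin> R s"
      then show ?thesis using z[of r'] r by blast
    next
      assume "r \<notin> R s" "r' \<in> R s"
      then show ?thesis using z[of r] r by blast
    next
      assume "r \<notin> R s" "r' \<notin> R s"
      then show ?thesis using one[of r r'] le_e r by blast
    qed
  qed
  moreover obtain h w q where "chain s h w q" using ch by blast
  then have "chain (insert z s) h w q" by (simp add: chain_def)
  ultimately show ?thesis using s by (auto simp: lost_def)
qed

lemma level_cases:
  assumes "lost s"
  obtains "level s = 0" "\<exists>p\<in>s. e b < p"
  | "level s = 1" "\<not> (\<exists>p\<in>s. e b < p)" "full s" "\<exists>w\<in>s. a < w \<and> w < b - 1"
  | "level s = 2" "\<not> (\<exists>p\<in>s. e b < p)" "full s" "\<not> (\<exists>w\<in>s. a < w \<and> w < b - 1)"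
      "\<exists>h\<in>s. h < a \<and> e (e (b - 1)) < h + n"
  | "level s = 3" "\<not> (\<exists>p\<in>s. e b < p)" "full s" "\<not> (\<exists>w\<in>s. a < w \<and> w < b - 1)"
      "\<not> (\<exists>h\<in>s. h < a \<and> e (e (b - 1)) < h + n)"
  | "level s = 4" "\<not> (\<exists>p\<in>s. e b < p)" "\<not> full s" "\<exists>q\<in>s. e (b - 1) < q"
  | "level s = 5" "\<not> (\<exists>p\<in>s. e b < p)" "\<not> full s" "\<not> (\<exists>q\<in>s. e (b - 1) < q)"
  unfolding level_def by (smt (verit))

lemma full_chain:
  assumes "s \<subseteq> {c..<c + n}" "full s" "w \<in> s" "a < w" "w < b"
  obtains h q where "chain s h w q" "e h \<le> a" "e (b - 1) < q"
proof -
  obtain h q where hq: "h \<in> s" "h < a" "e h \<le> a" "q \<in> s" "e (b - 1) < q"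
    using assms(2) unfolding full_def by blast
  then have "chain s h w q"
    using assms b_lt_e e_mono[of w "b - 1"] by (auto simp: chain_def)
  then show ?thesis using hq that by blast
qed

text \<open>The apex never witnesses a condition that decides the level: it fails the strict
  inequalities, by \<open>a + 1 \<le> e d\<close> and \<open>d + n \<le> e (e (b - 1))\<close>. The
  exception is \<open>a + 1\<close>, which may be an inner point below \<open>b - 1\<close>, but
  levels 0 and 4 are decided without that condition.\<close>

lemma level_toggle:
  assumes agree: "\<And>v. v \<noteq> apex (level s) \<Longrightarrow> v \<in> s \<longleftrightarrow> v \<in> t"
  shows "level t = level s"
proof -
  let ?z = "apex (level s)"
  have ex: "(\<exists>v\<in>t. P v) \<longleftrightarrow> (\<exists>v\<in>s. P v)" if "\<not> P ?z" for P
    using that agree by metis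
  have "\<not> e b < ?z"
    using a_lt_b le_e[of b] e_mono[of "b - 1" b] d_lt_a by (auto simp: apex_def)
  note 0 = ex[of "\<lambda>v. e b < v", OF this]
  have "\<not> (?z < a \<and> e ?z \<le> a)"
    using a_lt_b b_lt_e d_iff[of d] by (auto simp: apex_def)
  note h = ex[of "\<lambda>v. v < a \<and> e v \<le> a", OF this]
  have "\<not> e (b - 1) < ?z"
    using a_lt_b b_lt_e d_lt_a by (auto simp: apex_def)
  note q = ex[of "\<lambda>v. e (b - 1) < v", OF this]
  have "\<not> (?z < a \<and> e (e (b - 1)) < ?z + n)"
    using a_lt_b b_lt_e d_le by (auto simp: apex_def)
  note 2 = ex[of "\<lambda>v. v < a \<and> e (e (b - 1)) < v + n", OF this]
  have full: "full t \<longleftrightarrow> full s" using h q by (simp add: full_def)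
  show ?thesis
  proof (cases "(\<exists>p\<in>s. e b < p) \<or> \<not> full s")
    case True
    then show ?thesis using 0 q full unfolding level_def by (elim disjE) simp_all
  next
    case False
    then have "level s \<noteq> 0" "level s \<noteq> 4" by (simp_all add: level_def)
    then have "\<not> (a < ?z \<and> ?z < b - 1)"
      using b_lt_e d_lt_a by (auto simp: apex_def)
    note 1 = ex[of "\<lambda>v. a < v \<and> v < b - 1", OF this]
    show ?thesis by (simp only: level_def 0 1 2 q full)
  qed
qed

lemma lost_toggle:
  assumes s: "s \<subseteq> {c..<c + n}" "lost s"
  defines "z \<equiv> apex (level s)"
  shows "lost (insert z s) \<and> lost (s - {z})"
proof -
  have chain_bounds: "a < w \<and> w < b \<and> e w < q" if "chain s h w q" for h w q
  proof -
    have "c \<le> h" using that s by (auto simp: chain_def)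
    then show ?thesis using that c_iff[of h] by (auto simp: chain_def)
  qed
  have arc: ?thesis if z: "a < z" "z < b" and ch: "(\<exists>p\<in>s. e b < p) \<or> (\<exists>h w q. chain s h w q \<and> w \<noteq> z)"
    using lost_toggle_arc[OF s(2) _ z ch, of "insert z s"] lost_toggle_arc[OF s(2) _ z ch, of "s - {z}"]
    by simp
  have ex_chain: "\<exists>h w q. chain s h w q" if "\<not> (\<exists>p\<in>s. e b < p)"
    using s(2) that by (auto simp: lost_def)
  show ?thesis
  proof (cases rule: level_cases[OF s(2)])
    case 1
    then show ?thesis using a_lt_b by (intro arc) (auto simp: z_def apex_def)
  next
    case 2
    then obtain w where w: "w \<in> s" "a < w" "w < b - 1" by blast
    then have "w < b" by simp
    then obtain h q where "chain s h w q" using full_chain[OF s(1) 2(3) w(1,2)] by blast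
    then show ?thesis using a_lt_b w 2(1) by (intro arc) (auto simp: z_def apex_def)
  next
    case 3
    have z: "z = d" using 3(1) by (simp add: z_def apex_def)
    obtain h0 where h0: "h0 \<in> s" "h0 < a" "e (e (b - 1)) < h0 + n" using 3(5) by blast
    obtain w where w: "w \<in> s" "a < w" "w < b"
      using ex_chain[OF 3(2)] chain_bounds unfolding chain_def by blast
    obtain h q where ch: "chain s h w q" "e h \<le> a" using full_chain[OF s(1) 3(3) w] by blast
    have "h \<noteq> d" "w \<noteq> d" "q \<noteq> d"
      using ch w d_iff[of h] d_lt_a by (auto simp: chain_def)
    then have "lost (s - {d})"
      using ch d_lt_a a_lt_b apex_in[of 2] s by (intro lost_remove) (auto simp: apex_def)
    moreover have "lost (insert d s)"
    proof (rule lost_insert[OF s(2)])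
      have new: "z' = d + n" if "z' \<in> R (insert d s) - R s" for z'
        using that d_lt_a a_lt_b by (auto simp: R_def)
      then show "z' = z''" if "z' \<in> R (insert d s) - R s" "z'' \<in> R (insert d s) - R s" for z' z''
        using that by metis
      fix z' assume "z' \<in> R (insert d s) - R s"
      then have z': "z' = d + n" by (rule new)
      have "r \<le> e z' \<and> z' \<le> e r" if r: "r \<in> R s" for r
      proof
        show "r \<le> e z'"
          using R_bounds[OF s(1) r] d_iff[of d] by (simp add: z' e_period)
        have "c \<le> h0" using h0 s by auto
        then have "h0 + n \<in> R s" using h0 e_b le_e[of b] by (simp add: R_def)
        then have "h0 + n \<le> e r" using s(2) r unfolding lost_def valid_def by blast
        then show "z' \<le> e r" using h0 d_le by (simp add: z')
      qed
      then show "z' \<le> e z' \<and> (\<forall>r\<in>R s. r \<le> e z' \<and> z' \<le> e r)" using le_e by blast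
    qed (use ch in blast)
    ultimately show ?thesis by (simp add: z)
  next
    case 4
    have z: "z = e (b - 1)" using 4(1) by (simp add: z_def apex_def)
    obtain w where w: "w \<in> s" "a < w" "w < b"
      using ex_chain[OF 4(2)] chain_bounds unfolding chain_def by blast
    obtain h q where ch: "chain s h w q" "e (b - 1) < q" using full_chain[OF s(1) 4(3) w] by blast
    have "h \<noteq> z" "w \<noteq> z" "q \<noteq> z"
      using ch w a_lt_b b_lt_e by (auto simp: chain_def z)
    then have "lost (s - {z})"
      using ch a_lt_b b_lt_e apex_in[of 3] s by (intro lost_remove) (auto simp: apex_def z)
    moreover have "lost (insert z s)"
    proof (rule lost_insert[OF s(2)])
      have new: "z' = z" if "z' \<in> R (insert z s) - R s" for z'
        using that a_lt_b b_lt_e by (auto simp: R_def z)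
      then show "z' = z''" if "z' \<in> R (insert z s) - R s" "z'' \<in> R (insert z s) - R s" for z' z''
        using that by metis
      fix z' assume "z' \<in> R (insert z s) - R s"
      then have z': "z' = z" by (rule new)
      have "r \<le> e z' \<and> z' \<le> e r" if r: "r \<in> R s" for r
      proof
        have rb: "b < r" "r < a + n" using R_bounds[OF s(1) r] by auto
        show "z' \<le> e r" using rb e_mono[of "b - 1" r] by (simp add: z' z)
        \<comment> \<open>A point of \<open>R s\<close> that lies in \<open>s\<close> is at most
          \<open>e b\<close> because level 0 is excluded; a translated one is at most
          \<open>e (e (b - 1))\<close> because level 2 is excluded.\<close>
        show "r \<le> e z'"
        proof (cases "r \<in> s")
          case True
          then show ?thesis using 4(2) e_mono[of b z] b_lt_e by (force simp: z' z)
        next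
          case False
          then have "r - n \<in> s" using r by (simp add: R_def)
          then have "r - n < a \<Longrightarrow> \<not> e (e (b - 1)) < r - n + n" using 4(5) by blast
          then show ?thesis using rb by (simp add: z' z)
        qed
      qed
      then show "z' \<le> e z' \<and> (\<forall>r\<in>R s. r \<le> e z' \<and> z' \<le> e r)" using le_e by blast
    qed (use ch in blast)
    ultimately show ?thesis by simp
  next
    case 5
    obtain h w q where ch: "chain s h w q" using ex_chain[OF 5(2)] by blast
    \<comment> \<open>Some \<open>q\<close> lies beyond \<open>e (b - 1)\<close>, so it is the other
      half of fullness that fails.\<close>
    then have "\<not> e h \<le> a" using 5(3,4) unfolding full_def chain_def by blast
    then have "w \<noteq> a + 1" using ch by (auto simp: chain_def)
    then show ?thesis using a_lt_b ch 5(1) by (intro arc) (auto simp: z_def apex_def)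
  next
    case 6
    obtain h w q where ch: "chain s h w q" using ex_chain[OF 6(2)] by blast
    then have "e w < e (b - 1)" using 6(4) unfolding chain_def by (meson linorder_not_less order_less_le_trans)
    then have "w \<noteq> b - 1" by auto
    then show ?thesis using a_lt_b ch 6(1) by (intro arc) (auto simp: z_def apex_def)
  qed
qed

theorem removal_homotopy_eqv: "realize {c..<c + n} K homotopy_eqv realize {c..<c + n} L"
proof (rule graded_cone_removal_homotopy_eqv[where lev = level and apex = apex and N = 6])
  show "L \<subseteq> K" by (rule L_subset_K)
  show "{} \<in> L" by (simp add: arc_complex_def)
  show "s \<in> K \<Longrightarrow> s \<subseteq> {c..<c + n}" for s by (rule K_subset)
  show "level s \<le> level t" if "t \<subseteq> s" for s t using that by (rule level_mono)
  show "level s < 6" for s by (simp add: level_def)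
  show "apex (level s) \<in> {c..<c + n}" for s by (rule apex_in)
  fix s assume "s \<in> K - L"
  then have s: "s \<subseteq> {c..<c + n}" "lost s" by (auto simp only: lost_iff)
  show "insert (apex (level s)) s \<in> K - L \<and> level (insert (apex (level s)) s) = level s"
    using lost_toggle[OF s] s apex_in level_toggle[of s "insert (apex (level s)) s"]
    unfolding lost_iff by blast
  show "s - {apex (level s)} \<in> K - L \<and> level (s - {apex (level s)}) = level s"
    using lost_toggle[OF s] s level_toggle[of s "s - {apex (level s)}"]
    unfolding lost_iff by blast
qed (use arc_complex_down in blast)+

corollary arc_space_removal: "arc_space n e x homotopy_eqv arc_space n e' x"
  using arc_space_rotate[OF n_pos, of e x c] removal_homotopy_eqv arc_space_rotate[OF n_pos, of e' c x]
  unfolding arc_space_def by (meson homotopy_eqv_trans)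

end

text \<open>Induction on the total excess of \<open>e\<close> over \<open>e0\<close> in one period.
  Intermediate systems inherit the bound on three arcs from \<open>e\<close> above and the bound on
  four arcs from \<open>e0\<close> below.\<close>

lemma arc_space_sandwich:
  assumes "arc_system n e0" "arc_system n e" and le: "\<And>i. e0 i \<le> e i"
    and three: "\<And>i. e (e (e i) + 1) < i + n" and four: "\<And>i. i + n < e0 (e0 (e0 (e0 i)))"
  shows "arc_space n e x homotopy_eqv arc_space n e0 x"
  using assms(2) le three
proof (induction "nat (\<Sum>i\<in>{0..<n}. e i - e0 i)" arbitrary: e rule: less_induct)
  case (less e)
  interpret e0: arc_system n e0 by fact
  interpret e: arc_system n e by fact
  show ?case
  proof (cases "e = e0")
    case True
    then show ?thesis by (simp add: homotopy_equivalent_space_refl)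
  next
    case False
    then obtain i where "e i \<noteq> e0 i" by auto
    then have i: "e0 i < e i" using less.prems(2)[of i] by simp
    \<comment> \<open>The least start with the same end as \<open>i\<close>: all earlier arcs end
      strictly before, so shortening here keeps the system monotone, and
      \<open>e0 a \<le> e0 i\<close> leaves room for it.\<close>
    obtain a where a: "\<And>j. e i \<le> e j \<longleftrightarrow> a \<le> j" using e.ex_lower_adjoint[of "e i"] by blast
    have "a \<le> i" using a[of i] by simp
    then have ea: "e a = e i" using a[of a] e.e_mono[of a i] by simp
    then have "e0 a < e a" using e0.e_mono[OF \<open>a \<le> i\<close>] i by simp
    define e' where "e' = (\<lambda>j. if n dvd j - a then e j - 1 else e j)"
    have e0e': "e0 j \<le> e' j" for j
    proof (cases "n dvd j - a")
      case True
      then have "\<exists>k. j - a = n * k" unfolding dvd_def .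
      then obtain k where "j - a = n * k" by blast
      then have "j = a + k * n" by (simp add: algebra_simps)
      then show ?thesis using e.e_shift[of a k] e0.e_shift[of a k] \<open>e0 a < e a\<close> True
        by (simp add: e'_def)
    qed (use less.prems(2) in \<open>simp add: e'_def\<close>)
    have e'e: "e' j \<le> e j" for j by (simp add: e'_def)
    have e': "arc_system n e'"
    proof
      show "0 < n" by (rule e.n_pos)
      show "j \<le> e' j" for j using e0e'[of j] e0.le_e[of j] by simp
      show "e' (j + n) = e' j + n" for j
      proof -
        have "j + n - a = (j - a) + n" by simp
        then have "n dvd j + n - a \<longleftrightarrow> n dvd j - a" by (simp only: dvd_add_triv_right_iff)
        then show ?thesis by (simp add: e'_def e.e_period)
      qed
      show "mono e'"
      proof (rule monoI)
        fix j l :: int assume "j \<le> l"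
        show "e' j \<le> e' l"
        proof (cases "n dvd l - a \<and> j \<noteq> l")
          case True
          then have "\<exists>k. l - a = n * k" unfolding dvd_def by blast
          then obtain k where "l - a = n * k" by blast
          then have l: "l = a + k * n" by (simp add: algebra_simps)
          have "\<not> e i \<le> e (j - k * n)" using a True \<open>j \<le> l\<close> l by simp
          then have "e j < e i + k * n" using e.e_shift[of j "- k"] by simp
          then have "e j < e l" using e.e_shift[of a k] l ea by simp
          then show ?thesis by (simp add: e'_def)
        next
          case False
          then show ?thesis using e.e_mono[OF \<open>j \<le> l\<close>] by (auto simp: e'_def)
        qed
      qed
    qed
    interpret e': arc_system n e' by fact
    have "i + n < e' (e' (e' (e' i)))" for i
    proof -
      have "e0 (e0 (e0 (e0 i))) \<le> e' (e' (e' (e' i)))"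
        by (meson e0e' e'.e_mono order_trans)
      then show ?thesis using four[of i] by simp
    qed
    then interpret arc_removal n e e' a
      using less.prems(3) by unfold_locales (auto simp: e'_def)
    have "arc_space n e' x homotopy_eqv arc_space n e0 x"
    proof (rule less.hyps[OF _ e' e0e'])
      show "e' (e' (e' j) + 1) < j + n" for j
      proof -
        have "e' (e' (e' j) + 1) \<le> e (e (e j) + 1)"
          by (meson e'e e.e_mono order_trans add_right_mono)
        then show ?thesis using less.prems(3)[of j] by simp
      qed
      have "(\<Sum>j\<in>{0..<n}. e' j - e0 j) < (\<Sum>j\<in>{0..<n}. e j - e0 j)"
      proof (rule sum_strict_mono_ex1)
        have "n dvd a mod n - a" by (simp add: mod_eq_dvd_iff[symmetric])
        then have "e' (a mod n) - e0 (a mod n) < e (a mod n) - e0 (a mod n)" by (simp add: e'_def)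
        then show "\<exists>j\<in>{0..<n}. e' j - e0 j < e j - e0 j" using e.n_pos by (intro bexI[of _ "a mod n"]) auto
      qed (use e'e in auto)
      moreover have "0 \<le> (\<Sum>j\<in>{0..<n}. e' j - e0 j)" using e0e' by (simp add: sum_nonneg)
      ultimately show "nat (\<Sum>j\<in>{0..<n}. e' j - e0 j) < nat (\<Sum>j\<in>{0..<n}. e j - e0 j)" by simp
    qed
    then show ?thesis using arc_space_removal homotopy_eqv_trans by blast
  qed
qed

section \<open>Uniform arcs\<close>

lemma arc_system_uniform: "0 < n \<Longrightarrow> 0 \<le> l \<Longrightarrow> arc_system n (\<lambda>i. i + l)"
  by unfold_locales (auto intro: monoI)

text \<open>The smaller circle sits inside the larger one at the points \<open>t j\<close>, and every
  other point \<open>x\<close> is dominated by the preceding one, \<open>t (J x)\<close>.\<close>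

lemma arc_space_uniform_rescale:
  fixes n N l m :: int
  assumes n: "0 < n" "n \<le> N" and scale: "l * N \<le> m * n"
    and three: "3 * m + 1 < N" and four: "n < 4 * l"
  shows "arc_space N (\<lambda>i. i + m) 0 homotopy_eqv arc_space n (\<lambda>i. i + l) 0"
proof -
  have N: "0 < N" and l: "1 \<le> l" using n four by auto
  have "0 \<le> m * n" using scale l N by (smt (verit) mult_nonneg_nonneg)
  then have m: "0 \<le> m" using n by (simp add: zero_le_mult_iff)
  define t where "t = (\<lambda>j. j * N div n)"
  have le_div_iff: "i \<le> j div q \<longleftrightarrow> i * q \<le> j" if "0 < q" for i j q :: int
  proof
    assume "i \<le> j div q"
    then have "i * q \<le> j div q * q" using that by simp
    then show "i * q \<le> j" using div_mult_mod_eq[of j q] pos_mod_sign[OF that, of j] by linarith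
  next
    assume "i * q \<le> j"
    then have "i * q div q \<le> j div q" using that by (rule zdiv_mono1)
    then show "i \<le> j div q" using that by simp
  qed
  \<comment> \<open>The upper adjoint of \<open>t\<close>: \<open>J x\<close> is the last index
    embedded at or before \<open>x\<close>, that is, the largest \<open>j\<close> with
    \<open>j * N < (x + 1) * n\<close>.\<close>
  define J where "J = (\<lambda>x. ((x + 1) * n - 1) div N)"
  have galois: "t j \<le> x \<longleftrightarrow> j \<le> J x" for j x
  proof -
    have "t j \<le> x \<longleftrightarrow> \<not> x + 1 \<le> j * N div n" by (auto simp: t_def)
    also have "\<dots> \<longleftrightarrow> j * N < (x + 1) * n" using le_div_iff[OF n(1)] by (simp add: not_le)
    also have "\<dots> \<longleftrightarrow> j * N \<le> (x + 1) * n - 1" by auto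
    also have "\<dots> \<longleftrightarrow> j \<le> J x" unfolding J_def by (rule le_div_iff[OF N, symmetric])
    finally show ?thesis .
  qed
  have t_mono: "t i \<le> t j" if "i \<le> j" for i j
    unfolding t_def using that n N by (intro zdiv_mono1 mult_right_mono) auto
  have J_mono: "J x \<le> J y" if "x \<le> y" for x y
  proof -
    have "(x + 1) * n \<le> (y + 1) * n" using that n by (intro mult_right_mono) auto
    then show ?thesis unfolding J_def using N by (intro zdiv_mono1) auto
  qed
  have t_period: "t (j + k * n) = t j + k * N" for j k
  proof -
    have "(j + k * n) * N = j * N + (k * N) * n" by (simp add: algebra_simps)
    then show ?thesis unfolding t_def using n by (simp only: div_mult_self1)
  qed
  have J_period: "J (x + k * N) = J x + k * n" for x k
  proof -
    have "(x + k * N + 1) * n - 1 = ((x + 1) * n - 1) + (k * n) * N" by (simp add: algebra_simps)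
    then show ?thesis unfolding J_def using N by (simp only: div_mult_self1)
  qed
  have t_strict: "t j < t (j + 1)" for j
  proof -
    have "t j + 1 = (j * N + 1 * n) div n" unfolding t_def using n by (subst div_mult_self1) auto
    also have "\<dots> \<le> t (j + 1)" unfolding t_def using n by (intro zdiv_mono1) (auto simp: algebra_simps)
    finally show ?thesis by simp
  qed
  have Jt: "J (t j) = j" for j
    using galois[of j "t j"] galois[of "j + 1" "t j"] t_strict[of j] by simp
  have tJ: "t (J x) \<le> x" "x < t (J x + 1)" for x
    using galois[of "J x" x] galois[of "J x + 1" x] by auto
  have t0: "t 0 = 0" by (simp add: t_def)
  have J1: "J (- 1) = - 1"
    using galois[of "- 1" "- 1"] galois[of 0 "- 1"] t_strict[of "- 1"] t0 by simp
  have tV: "t j \<in> {0..<0 + N} \<longleftrightarrow> j \<in> {0..<n}" for j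
    using galois[of j "- 1"] galois[of j "- 1 + 1 * N"] J_period[of "- 1" 1] J1 by auto
  \<comment> \<open>The arcs of the smaller circle transported to the larger one, constant on the
    stretch from one embedded point up to the next. Their lengths vary, which is why general arc
    systems are needed.\<close>
  define e where "e = (\<lambda>x. t (J x + l))"
  have Je: "J (e x) = J x + l" for x by (simp add: e_def Jt)
  have e_sys: "arc_system N e"
  proof
    show "mono e" unfolding e_def by (intro monoI t_mono add_right_mono J_mono)
    show "e (i + N) = e i + N" for i
      using J_period[of i 1] t_period[of "J i + l" 1] by (simp add: e_def add.commute add.left_commute)
    show "i \<le> e i" for i
      using tJ(2)[of i] t_mono[of "J i + 1" "J i + l"] l by (simp add: e_def)
  qed (rule N)
  have shrink: "arc_space N (\<lambda>i. i + m) 0 homotopy_eqv arc_space N e 0"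
  proof (rule arc_space_sandwich[OF e_sys arc_system_uniform[OF N m]])
    fix i
    have "e i \<le> ((J i) * N + m * n) div n"
      unfolding e_def t_def using scale n by (intro zdiv_mono1) (auto simp: algebra_simps)
    also have "\<dots> = t (J i) + m" using n by (simp add: t_def)
    finally show "e i \<le> i + m" using tJ(1)[of i] by simp
    show "i + m + m + 1 + m < i + N" using three by simp
    \<comment> \<open>Each step advances \<open>J\<close> by exactly \<open>l\<close>, so rounding
      does not accumulate, and \<open>n + 1 \<le> 4 * l\<close> absorbs the initial rounding of
      \<open>i\<close> down to \<open>t (J i)\<close>.\<close>
    have "e (e (e (e i))) = t (J i + 4 * l)" by (simp add: e_def Jt algebra_simps)
    moreover have "t (J i + 1 + 1 * n) \<le> t (J i + 4 * l)" using four by (intro t_mono) simp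
    ultimately show "i + N < e (e (e (e i)))"
      using tJ(2)[of i] t_period[of "J i + 1" 1] by simp
  qed
  define T where "T = t ` {0..<n}"
  have retract: "arc_space N e 0 homotopy_eqv realize T {s \<in> arc_complex N e 0. s \<subseteq> T}"
    unfolding arc_space_def
  proof (rule simplicial_retract_homotopy_eqv[where f = "\<lambda>x. t (J x)"])
    show "T \<subseteq> {0..<0 + N}" unfolding T_def using tV by blast
    have "J x \<in> {0..<n}" if "x \<in> {0..<0 + N}" for x
      using that galois[of 0 x] galois[of n x] t0 t_period[of 0 1] by auto
    then show fT: "(\<lambda>x. t (J x)) ` {0..<0 + N} \<subseteq> T" unfolding T_def by blast
    show "t (J v) = v" if "v \<in> T" for v
    proof -
      obtain j where "v = t j" using \<open>v \<in> T\<close> unfolding T_def by blast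
      then show ?thesis by (simp add: Jt)
    qed
    fix s assume s: "s \<in> arc_complex N e 0"
    then show sV: "s \<subseteq> {0..<0 + N}" by (simp add: arc_complex_def)
    obtain x y where xy: "\<And>v. v \<in> s \<Longrightarrow> \<exists>k. v + k * N \<in> {x..e x} \<union> {y..e y}"
      using s unfolding arc_complex_def by blast
    show "s \<union> (\<lambda>x. t (J x)) ` s \<in> arc_complex N e 0"
    proof (rule arc_complexI[where x = "t (J x)" and y = "t (J y)"])
      show "s \<union> (\<lambda>x. t (J x)) ` s \<subseteq> {0..<0 + N}"
        using sV fT \<open>T \<subseteq> {0..<0 + N}\<close> by blast
      \<comment> \<open>Moving the start of an arc back to the embedded point does not change its
        end, so the enlarged arcs still belong to the system and contain the points together with
        their images.\<close>
      have et: "e (t (J z)) = e z" for z by (simp add: e_def Jt)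
      fix v assume "v \<in> s \<union> (\<lambda>x. t (J x)) ` s"
      then obtain u where u: "u \<in> s" "v = u \<or> v = t (J u)" by blast
      obtain k where k: "u + k * N \<in> {x..e x} \<union> {y..e y}" using xy[OF u(1)] by blast
      have fu: "t (J u) + k * N = t (J (u + k * N))" by (simp add: J_period t_period)
      have *: "v + k * N \<in> {t (J z)..e (t (J z))}" if "u + k * N \<in> {z..e z}" for z
        using u(2)
      proof
        assume "v = u"
        then show ?thesis using that tJ(1)[of z] et[of z] by simp
      next
        assume v: "v = t (J u)"
        have "J z \<le> J (u + k * N)" using that by (intro J_mono) simp
        then show ?thesis
          using that fu v t_mono tJ(1)[of "u + k * N"] et[of z] by simp
      qed
      then show "\<exists>k. v + k * N \<in> {t (J x)..e (t (J x))} \<union> {t (J y)..e (t (J y))}"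
        using k by blast
    qed
  qed (use arc_complex_down in auto)
  have relabel: "arc_space n (\<lambda>i. i + l) 0 homotopy_eqv realize T {s \<in> arc_complex N e 0. s \<subseteq> T}"
    unfolding arc_space_def
  proof (rule relabel_homotopy_eqv[where g = t])
    have "inj_on t {0..<n}" by (rule inj_on_inverseI[of _ J]) (rule Jt)
    then show "bij_betw t {0..<0 + n} T" unfolding T_def bij_betw_def by simp
    have T: "T \<subseteq> {0..<0 + N}" unfolding T_def using tV by blast
    fix s assume s: "s \<subseteq> {0..<0 + n}"
    show "t ` s \<in> {s \<in> arc_complex N e 0. s \<subseteq> T} \<longleftrightarrow> s \<in> arc_complex n (\<lambda>i. i + l) 0"
    proof
      assume "t ` s \<in> {s \<in> arc_complex N e 0. s \<subseteq> T}"
      then obtain x y where "\<forall>v\<in>t ` s. \<exists>k. v + k * N \<in> {x..e x} \<union> {y..e y}"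
        unfolding arc_complex_def by blast
      then have xy: "\<exists>k. t v + k * N \<in> {x..e x} \<union> {y..e y}" if "v \<in> s" for v
        using that by (simp only: ball_simps)
      have *: "v + k * n \<in> {J z..J z + l}" if "t v + k * N \<in> {z..e z}" for v k z
      proof -
        have "z \<le> t (v + k * n)" "t (v + k * n) \<le> e z" using that by (simp_all add: t_period)
        then have "J z \<le> J (t (v + k * n))" "J (t (v + k * n)) \<le> J (e z)" by (simp_all only: J_mono)
        then show ?thesis by (simp only: Jt Je) simp
      qed
      show "s \<in> arc_complex n (\<lambda>i. i + l) 0"
        using xy * by (intro arc_complexI[OF s, of "J x" _ "J y"]) blast
    next
      assume "s \<in> arc_complex n (\<lambda>i. i + l) 0"
      then obtain x y where xy: "\<And>v. v \<in> s \<Longrightarrow> \<exists>k. v + k * n \<in> {x..x + l} \<union> {y..y + l}"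
        unfolding arc_complex_def by blast
      have *: "t v + k * N \<in> {t z..e (t z)}" if "v + k * n \<in> {z..z + l}" for v k z
      proof -
        have "t z \<le> t (v + k * n)" "t (v + k * n) \<le> t (z + l)" using that by (simp_all add: t_mono)
        then show ?thesis by (simp add: t_period e_def Jt)
      qed
      have "t ` s \<subseteq> T" using s unfolding T_def by auto
      moreover have "t ` s \<in> arc_complex N e 0"
      proof (rule arc_complexI[of _ _ _ "t x" _ "t y"])
        show "t ` s \<subseteq> {0..<0 + N}" using T \<open>t ` s \<subseteq> T\<close> by blast
        fix u assume "u \<in> t ` s"
        then obtain v where v: "v \<in> s" "u = t v" by blast
        obtain k where "v + k * n \<in> {x..x + l} \<union> {y..y + l}" using xy[OF v(1)] by blast
        then have "u + k * N \<in> {t x..e (t x)} \<union> {t y..e (t y)}" using * v(2) by blast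
        then show "\<exists>k. u + k * N \<in> {t x..e (t x)} \<union> {t y..e (t y)}" by blast
      qed
      ultimately show "t ` s \<in> {s \<in> arc_complex N e 0. s \<subseteq> T}" by simp
    qed
  qed (auto simp: arc_complex_def)
  show ?thesis
    using homotopy_eqv_trans[OF homotopy_eqv_trans[OF shrink retract]] relabel homotopy_equivalent_space_sym
    by blast
qed

text \<open>Two arcs of three points cover at most six of the seven points. Conversely, the six
  points other than \<open>w\<close> split into the arcs from \<open>w + 1\<close> and from
  \<open>w + 4\<close>.\<close>

lemma arc_complex_7: "arc_complex 7 (\<lambda>i. i + 2) 0 = {s. s \<subset> {0..<7}}"
proof (intro equalityI subsetI CollectI)
  fix s assume s: "s \<in> arc_complex 7 (\<lambda>i. i + 2) 0"
  then obtain x y where xy: "\<And>v. v \<in> s \<Longrightarrow> \<exists>k. v + k * 7 \<in> {x..x + 2} \<union> {y..y + 2}"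
    unfolding arc_complex_def by blast
  have "s \<subseteq> (\<lambda>v. v mod 7) ` ({x, x + 1, x + 2} \<union> {y, y + 1, y + 2})"
  proof
    fix v assume v: "v \<in> s"
    then obtain k where "v + k * 7 \<in> {x..x + 2} \<union> {y..y + 2}" using xy by blast
    then have "v + k * 7 \<in> {x, x + 1, x + 2} \<union> {y, y + 1, y + 2}" by auto
    moreover have "v \<in> {0..<7}" using v s by (auto simp: arc_complex_def)
    then have "v = (v + k * 7) mod 7" by simp
    ultimately show "v \<in> (\<lambda>v. v mod 7) ` ({x, x + 1, x + 2} \<union> {y, y + 1, y + 2})" by blast
  qed
  then have "card s \<le> card ((\<lambda>v. v mod 7) ` ({x, x + 1, x + 2} \<union> {y, y + 1, y + 2}))"
    by (intro card_mono) auto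
  also have "\<dots> \<le> card ({x, x + 1, x + 2} \<union> {y, y + 1, y + 2})" by (intro card_image_le) auto
  also have "\<dots> \<le> card {x, x + 1, x + 2} + card {y, y + 1, y + 2}" by (rule card_Un_le)
  also have "\<dots> \<le> 6" by simp
  finally have "s \<noteq> {0..<7}" by auto
  then show "s \<subset> {0..<7}" using s by (auto simp: arc_complex_def)
next
  fix s :: "int set" assume "s \<in> {s. s \<subset> {0..<7}}"
  then have s: "s \<subseteq> {0..<0 + 7}" and "\<exists>w. w \<in> {0..<7} - s"
    using psubset_imp_ex_mem[of s "{0..<7}"] by (simp_all add: psubset_eq)
  then obtain w where w: "w \<in> {0..<7}" "w \<notin> s" by blast
  show "s \<in> arc_complex 7 (\<lambda>i. i + 2) 0"
  proof (rule arc_complexI[OF s, of "w + 1" _ "w + 4"])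
    fix v assume "v \<in> s"
    then have "v \<noteq> w" "v \<in> {0..<7}" using s w by auto
    then have "v + 0 * 7 \<in> {w + 1..w + 6} \<or> v + 1 * 7 \<in> {w + 1..w + 6}" using w by auto
    moreover have "{w + 1..w + 6} \<subseteq> {w + 1..w + 1 + 2} \<union> {w + 4..w + 4 + 2}" by auto
    ultimately show "\<exists>k. v + k * 7 \<in> {w + 1..w + 1 + 2} \<union> {w + 4..w + 4 + 2}" by blast
  qed
qed

section \<open>The boundary of a simplex\<close>

text \<open>Modulo the constant vectors, the coordinate space on \<open>{..Suc n}\<close> has
  coordinates \<open>x i - x (Suc n)\<close> for \<open>i \<le> n\<close>. Each ray of this quotient
  meets the boundary of the simplex once, in its representative with minimum \<open>0\<close> and
  sum \<open>1\<close>, and meets the sphere once. \<open>F\<close> and \<open>G\<close> rescale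
  along these rays.\<close>

lemma realize_simplex_boundary_nsphere:
  "realize {..Suc n} {s. s \<subset> {..Suc n}} homotopy_eqv {x. (\<Sum>i\<le>n. (x i)\<^sup>2) = (1::real) \<and> (\<forall>i>n. x i = 0)}"
    (is "?B homotopy_eqv ?S")
proof -
  define F where "F = (\<lambda>(x::nat \<Rightarrow> real) i. if i \<le> n then (x i - x (Suc n)) / sqrt (\<Sum>i\<le>n. (x i - x (Suc n))\<^sup>2) else 0)"
  define \<mu> where "\<mu> = (\<lambda>y::nat \<Rightarrow> real. Min (y ` {..Suc n}))"
  define G where "G = (\<lambda>(y::nat \<Rightarrow> real) i. if i \<le> Suc n then (y i - \<mu> y) / (\<Sum>i\<le>Suc n. y i - \<mu> y) else 0)"
  have zero: "\<exists>i\<le>Suc n. x i = 0" if "x \<in> ?B" for x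
    using that by (auto simp: realize_def)
  have Npos: "0 < (\<Sum>i\<le>n. (x i - x (Suc n))\<^sup>2)" if x: "x \<in> ?B" for x
  proof (rule ccontr)
    assume "\<not> ?thesis"
    moreover have "0 \<le> (\<Sum>i\<le>n. (x i - x (Suc n))\<^sup>2)" by (intro sum_nonneg) simp
    ultimately have "(\<Sum>i\<le>n. (x i - x (Suc n))\<^sup>2) = 0" by linarith
    then have "\<forall>i\<in>{..n}. (x i - x (Suc n))\<^sup>2 = 0" by (subst (asm) sum_nonneg_eq_0_iff) auto
    then have eq: "x i = x (Suc n)" if "i \<le> Suc n" for i
      using that by (cases "i = Suc n") auto
    obtain i0 where "i0 \<le> Suc n" "x i0 = 0" using zero[OF x] by blast
    then have "x i = 0" if "i \<le> Suc n" for i using eq[of i0] eq[OF that] by simp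
    then have "sum x {..Suc n} = 0" by (intro sum.neutral) auto
    then show False using x by (simp add: realize_def)
  qed
  have mu_le: "\<mu> y \<le> y i" if "i \<le> Suc n" for y i
    unfolding \<mu>_def using that by (intro Min_le) auto
  have Spos: "0 < (\<Sum>i\<le>Suc n. y i - \<mu> y)" if y: "y \<in> ?S" for y
  proof (rule ccontr)
    assume "\<not> ?thesis"
    moreover have "0 \<le> (\<Sum>i\<le>Suc n. y i - \<mu> y)" using mu_le by (intro sum_nonneg) auto
    ultimately have "(\<Sum>i\<le>Suc n. y i - \<mu> y) = 0" by linarith
    then have *: "\<forall>i\<in>{..Suc n}. y i - \<mu> y = 0"
      using mu_le by (subst (asm) sum_nonneg_eq_0_iff) auto
    have "y i = 0" if "i \<le> n" for i
      using *[rule_format, of i] *[rule_format, of "Suc n"] that y by simp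
    then have "(\<Sum>i\<le>n. (y i)\<^sup>2) = 0" by (intro sum.neutral) auto
    then show False using y by simp
  qed
  have F: "F x \<in> ?S" if x: "x \<in> ?B" for x
  proof -
    have "(\<Sum>i\<le>n. (F x i)\<^sup>2) = (\<Sum>i\<le>n. (x i - x (Suc n))\<^sup>2) / (sqrt (\<Sum>i\<le>n. (x i - x (Suc n))\<^sup>2))\<^sup>2"
      by (simp add: F_def power_divide sum_divide_distrib)
    also have "\<dots> = 1" using Npos[OF x] by simp
    finally show ?thesis by (simp add: F_def)
  qed
  have G: "G y \<in> ?B" if y: "y \<in> ?S" for y
  proof -
    have "sum (G y) {..Suc n} = (\<Sum>i\<le>Suc n. y i - \<mu> y) / (\<Sum>i\<le>Suc n. y i - \<mu> y)"
      unfolding sum_divide_distrib G_def by (intro sum.cong) auto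
    then have "sum (G y) {..Suc n} = 1" using Spos[OF y] by simp
    moreover have "0 \<le> G y i" for i using mu_le Spos[OF y] by (simp add: G_def)
    moreover have "\<mu> y \<in> y ` {..Suc n}" unfolding \<mu>_def by (intro Min_in) auto
    then obtain i where "i \<le> Suc n" "\<mu> y = y i" by auto
    then have "i \<notin> {i. G y i \<noteq> 0}" "i \<in> {..Suc n}" by (auto simp: G_def)
    then have "{i. G y i \<noteq> 0} \<subset> {..Suc n}" by (auto simp: G_def)
    moreover have "G y i = 0" if "i \<notin> {..Suc n}" for i using that by (simp add: G_def)
    ultimately show ?thesis unfolding realize_def by blast
  qed
  have "homeomorphism ?B ?S F G"
  proof (rule homeomorphismI)
    have cF: "continuous_on ?B (\<lambda>x. if i \<le> n then (x i - x (Suc n)) / sqrt (\<Sum>i\<le>n. (x i - x (Suc n))\<^sup>2) else 0)" for i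
    proof (cases "i \<le> n")
      case True
      have "\<forall>x\<in>?B. sqrt (\<Sum>i\<le>n. (x i - x (Suc n))\<^sup>2) \<noteq> 0" using Npos by fastforce
      then show ?thesis using True
        by (simp, intro continuous_intros continuous_on_eval[OF continuous_on_id]) auto
    qed simp
    show "continuous_on ?B F"
      unfolding F_def by (rule continuous_on_coordinatewise_then_product) (rule cF)
    have cmu: "continuous_on ?S \<mu>"
      unfolding \<mu>_def by (rule continuous_on_Min_coords) auto
    have cG: "continuous_on ?S (\<lambda>y. if i \<le> Suc n then (y i - \<mu> y) / (\<Sum>i\<le>Suc n. y i - \<mu> y) else 0)" for i
    proof (cases "i \<le> Suc n")
      case True
      have "\<forall>y\<in>?S. (\<Sum>i\<le>Suc n. y i - \<mu> y) \<noteq> 0" using Spos by fastforce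
      moreover have "continuous_on ?S (\<lambda>y. (\<Sum>i\<le>Suc n. y i - \<mu> y))"
        by (intro continuous_intros cmu continuous_on_eval[OF continuous_on_id])
      ultimately show ?thesis using True
        by (simp only: if_True) (intro continuous_on_divide continuous_on_diff cmu continuous_on_eval[OF continuous_on_id])
    qed simp
    show "continuous_on ?S G"
      unfolding G_def by (rule continuous_on_coordinatewise_then_product) (rule cG)
    show "G (F x) = x" if x: "x \<in> ?B" for x
    proof
      fix i
      define r where "r = sqrt (\<Sum>i\<le>n. (x i - x (Suc n))\<^sup>2)"
      have r: "0 < r" using Npos[OF x] by (simp add: r_def)
      have Fi: "F x i = (x i - x (Suc n)) / r" if "i \<le> Suc n" for i
        using that by (auto simp: F_def r_def le_Suc_eq)
      obtain i0 where i0: "i0 \<le> Suc n" "x i0 = 0" using zero[OF x] by blast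
      have "\<mu> (F x) = - x (Suc n) / r"
        unfolding \<mu>_def
      proof (rule Min_eqI)
        show "- x (Suc n) / r \<in> F x ` {..Suc n}"
          using Fi[OF i0(1)] i0 by (intro image_eqI[of _ _ i0]) auto
        show "- x (Suc n) / r \<le> z" if z: "z \<in> F x ` {..Suc n}" for z
        proof -
          obtain j where "z = (x j - x (Suc n)) / r" using z Fi by auto
          moreover have "0 \<le> x j" using x by (simp add: realize_def)
          ultimately show ?thesis using r by (simp add: divide_simps)
        qed
      qed simp
      then have d: "F x i - \<mu> (F x) = x i / r" if "i \<le> Suc n" for i
        using Fi[OF that] by (simp add: diff_divide_distrib)
      have "(\<Sum>i\<le>Suc n. F x i - \<mu> (F x)) = (\<Sum>i\<le>Suc n. x i / r)" using d by (intro sum.cong) auto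
      also have "\<dots> = 1 / r" using x by (simp only: sum_divide_distrib[symmetric]) (simp add: realize_def)
      finally show "G (F x) i = x i" using d[of i] r x by (auto simp: G_def realize_def)
    qed
    show "F (G y) = y" if y: "y \<in> ?S" for y
    proof
      fix i
      define S where "S = (\<Sum>i\<le>Suc n. y i - \<mu> y)"
      have S: "0 < S" using Spos[OF y] by (simp add: S_def)
      have Gj: "G y j = (y j - \<mu> y) / S" if "j \<le> Suc n" for j
        using that by (simp add: G_def S_def del: sum.atMost_Suc)
      have d: "G y i - G y (Suc n) = y i / S" if "i \<le> n" for i
        using that y Gj[of i] Gj[of "Suc n"] by (simp add: diff_divide_distrib)
      have "(\<Sum>i\<le>n. (G y i - G y (Suc n))\<^sup>2) = (\<Sum>i\<le>n. (y i)\<^sup>2 / S\<^sup>2)"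
        using d by (intro sum.cong) (auto simp: power_divide)
      also have "\<dots> = (1 / S)\<^sup>2" using y by (simp add: sum_divide_distrib[symmetric] power_divide)
      finally have "sqrt (\<Sum>i\<le>n. (G y i - G y (Suc n))\<^sup>2) = 1 / S" using S by simp
      then show "F (G y) i = y i" using d[of i] S y by (auto simp: F_def)
    qed
  qed (use F G in auto)
  then have "?B homeomorphic ?S" unfolding homeomorphic_def by blast
  then show ?thesis by (rule homeomorphic_imp_homotopy_eqv)
qed

lemma nsphere_eq: "nsphere n = top_of_set {x. (\<Sum>i\<le>n. (x i)\<^sup>2) = 1 \<and> (\<forall>i>n. x i = 0)}"
  by (simp add: nsphere euclidean_product_topology)

section \<open>Independent sets of the squared cycle\<close>

text \<open>Adjacency becomes a congruence that is easy to multiply by \<open>k + 1\<close>. As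
  \<open>n \<ge> 3\<close> divides none of the four differences, distinctness comes for
  free.\<close>

lemma sq_cycle_adj_iff:
  assumes n: "3 \<le> n" and i: "i \<in> {1..n}" and j: "j \<in> {1..n}"
  shows "sq_cycle_adj n i j \<longleftrightarrow> (\<exists>\<delta>\<in>{1, 2, -1, -2}. int n dvd int j - int i - \<delta>)"
proof -
  have succ: "j = (i + d) mod n + 1 \<longleftrightarrow> int n dvd int j - int i - (int d + 1)" if "j \<in> {1..n}" for i j d
  proof -
    have "j = (i + d) mod n + 1 \<longleftrightarrow> (j - 1) mod n = (i + d) mod n" using that by auto
    also have "\<dots> \<longleftrightarrow> int (j - 1) mod int n = int (i + d) mod int n"
      by (metis of_nat_eq_iff of_nat_mod)
    also have "\<dots> \<longleftrightarrow> int n dvd int (j - 1) - int (i + d)" by (rule mod_eq_dvd_iff)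
    also have "int (j - 1) - int (i + d) = int j - int i - (int d + 1)" using that by auto
    finally show ?thesis .
  qed
  have neg: "int n dvd int i - int j - d \<longleftrightarrow> int n dvd int j - int i - (- d)" for d
    by (metis (no_types, opaque_lifting) diff_minus_eq_add dvd_minus_iff minus_diff_eq add.commute diff_diff_eq2 diff_diff_eq)
  have ne: "i \<noteq> j" if "\<delta> \<in> {1, 2, -1, -2}" "int n dvd int j - int i - \<delta>" for \<delta>
  proof
    assume "i = j"
    then have "int n dvd \<bar>\<delta>\<bar>" using that(2) by simp
    then have "int n \<le> \<bar>\<delta>\<bar>" using that(1) by (intro zdvd_imp_le) auto
    then show False using that(1) n by auto
  qed
  have "sq_cycle_adj n i j \<longleftrightarrow> i \<noteq> j \<and> (\<exists>\<delta>\<in>{1, 2, -1, -2}. int n dvd int j - int i - \<delta>)"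
    using i j succ[of j i 0] succ[of i j 0] succ[of j i 1] succ[of i j 1] neg[of 1] neg[of 2]
    unfolding sq_cycle_adj_def by auto
  then show ?thesis using ne by blast
qed

lemma sum_periodic_window:
  fixes f :: "int \<Rightarrow> nat"
  assumes "\<And>z. f (z + int n) = f z"
  shows "(\<Sum>i<n. f (c + int i)) = (\<Sum>i<n. f (1 + int i))"
proof -
  have step: "(\<Sum>i<n. f (c + int i)) = (\<Sum>i<n. f ((c + 1) + int i))" for c
  proof -
    have "(\<Sum>i<Suc n. f (c + int i)) = (\<Sum>i<n. f (c + int i)) + f c"
      using assms[of c] by simp
    moreover have "(\<Sum>i<Suc n. f (c + int i)) = f c + (\<Sum>i<n. f ((c + 1) + int i))"
      unfolding sum.lessThan_Suc_shift by (simp add: add.assoc)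
    ultimately show ?thesis by simp
  qed
  show ?thesis
  proof (induction c rule: int_induct[where k = 1])
    case (step1 i)
    then show ?case using step[of i] by simp
  next
    case (step2 i)
    then show ?case using step[of "i - 1"] by simp
  qed simp
qed

lemma sum_triples:
  fixes f :: "nat \<Rightarrow> nat"
  shows "(\<Sum>i<k. f (3 * i) + f (3 * i + 1) + f (3 * i + 2)) = (\<Sum>j<3 * k. f j)"
proof (induction k)
  case (Suc k)
  have "3 * Suc k = Suc (Suc (Suc (3 * k)))" by simp
  then show ?case using Suc by (simp only: sum.lessThan_Suc) simp
qed simp

text \<open>Exactly two of the windows \<open>{z, z + 1, z + 2}\<close> miss an independent \<open>k\<close>-set \<open>S\<close>. Among the
  windows starting at \<open>v, v + 3, \<dots>, v + 3 k\<close>, which cover \<open>v\<close> twice and every other vertex once,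
  one misses \<open>S\<close> as soon as \<open>v \<notin> S\<close>.\<close>

lemma independent_set_empty_windows:
  fixes k n :: nat
  assumes n: "n = 3 * k + 2" and k: "1 \<le> k"
    and S: "S \<subseteq> {1..n}" "card S = k" "independent_set {1..n} (sq_cycle_adj n) S"
  obtains z1 z2 :: int where
    "\<And>v. v \<in> {1..n} - S \<Longrightarrow> \<exists>i\<le>k. \<exists>z\<in>{z1, z2}. int n dvd int v + 3 * int i - z"
proof -
  define f :: "int \<Rightarrow> nat" where "f = (\<lambda>z. if \<exists>v\<in>S. int n dvd z - int v then 1 else 0)"
  have period: "f (z + int n) = f z" for z
  proof -
    have "int n dvd z + int n - int v \<longleftrightarrow> int n dvd z - int v" for v
      by (metis add_diff_eq add.commute diff_add_eq dvd_add_triv_left_iff)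
    then show ?thesis by (simp add: f_def)
  qed
  have f_in: "f (int v) = (if v \<in> S then 1 else 0)" if "v \<in> {1..n}" for v
  proof -
    have "u = v" if "u \<in> S" "int n dvd int v - int u" for u
    proof -
      have "u \<in> {1..n}" using that S by blast
      then have "\<bar>int v - int u\<bar> < int n" using \<open>v \<in> {1..n}\<close> by auto
      then show ?thesis using that(2) dvd_imp_le_int[of "int v - int u" "int n"] by fastforce
    qed
    then show ?thesis by (auto simp: f_def)
  qed
  have total: "(\<Sum>i<n. f (c + int i)) = k" for c
  proof -
    have "(\<Sum>i<n. f (c + int i)) = (\<Sum>i<n. f (1 + int i))"
      using period by (rule sum_periodic_window)
    also have "\<dots> = (\<Sum>v\<in>{1..n}. f (int v))"
      by (rule sum.reindex_bij_witness[of _ "\<lambda>v. v - 1" Suc]) auto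
    also have "\<dots> = (\<Sum>v\<in>{1..n}. if v \<in> S then 1 else 0)" using f_in by (intro sum.cong) auto
    also have "\<dots> = card ({1..n} \<inter> S)" by (simp add: sum.If_cases)
    also have "\<dots> = k" using S by (simp add: Int_absorb1)
    finally show ?thesis .
  qed
  define w where "w = (\<lambda>z. f z + f (z + 1) + f (z + 2))"
  have sep: "f z = 0 \<or> f (z + d) = 0" if "d \<in> {1, 2}" for z d
  proof (rule ccontr)
    assume "\<not> ?thesis"
    then obtain u v where uv: "u \<in> S" "v \<in> S" "int n dvd z - int u" "int n dvd z + d - int v"
      by (auto simp: f_def split: if_splits)
    then have "int n dvd (z - int u) - (z + d - int v)" by (rule_tac dvd_diff)
    then have "int n dvd int v - int u - d" by (simp add: algebra_simps)
    then have "sq_cycle_adj n u v"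
      using uv S that n k by (subst sq_cycle_adj_iff) auto
    then show False using uv S by (auto simp: independent_set_def)
  qed
  have w_le: "w z \<le> 1" for z
  proof -
    have "f x \<le> 1" for x by (simp add: f_def)
    then show ?thesis
      using sep[of 1 z] sep[of 2 z] sep[of 1 "z + 1"] unfolding w_def
      by (smt (verit) add.assoc add.right_neutral add_0 insertI1 insertI2 one_add_one)
  qed
  define Z where "Z = {i. i < n \<and> w (int i) = 0}"
  \<comment> \<open>Every element of \<open>S\<close> lies in three windows. Since each
    \<open>w\<close> is \<open>0\<close> or \<open>1\<close>, the sum \<open>3 * k\<close> over
    \<open>3 * k + 2\<close> windows leaves exactly two of them empty.\<close>
  have "(\<Sum>i<n. w (int i)) = 3 * k"
    using total[of 0] total[of 1] total[of 2] by (simp add: w_def sum.distrib add.commute)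
  moreover have "(\<Sum>i<n. w (int i)) = (\<Sum>i<n. if i \<in> Z then 0 else 1)"
  proof (rule sum.cong)
    fix i assume "i \<in> {..<n}"
    then show "w (int i) = (if i \<in> Z then 0 else 1)" using w_le[of "int i"] by (auto simp: Z_def)
  qed simp
  moreover have "(\<Sum>i<n. if i \<in> Z then 0 else 1) = card ({..<n} - Z)"
    by (simp add: sum.If_cases Diff_eq)
  moreover have "card ({..<n} - Z) = n - card Z"
    by (subst card_Diff_subset) (auto simp: Z_def)
  moreover have "card Z \<le> n" by (rule subset_eq_atLeast0_lessThan_card) (auto simp: Z_def)
  ultimately have "card Z = 2" using n by linarith
  then obtain z1 z2 where Z: "Z = {z1, z2}" by (auto simp: card_2_iff)
  show thesis
  proof (rule that[of "int z1" "int z2"])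
    fix v assume v: "v \<in> {1..n} - S"
    have "(\<Sum>i<Suc k. w (int v + 3 * int i)) = (\<Sum>i<Suc k. f (int v + int (3 * i)) + f (int v + int (3 * i + 1)) + f (int v + int (3 * i + 2)))"
      by (simp add: w_def algebra_simps)
    also have "\<dots> = (\<Sum>j<3 * Suc k. f (int v + int j))" by (rule sum_triples)
    also have "3 * Suc k = Suc n" using n by simp
    also have "(\<Sum>j<Suc n. f (int v + int j)) = k"
      using total[of "int v"] period[of "int v"] f_in[of v] v by simp
    finally have sum: "(\<Sum>i<Suc k. w (int v + 3 * int i)) = k" .
    have "\<exists>i\<le>k. w (int v + 3 * int i) = 0"
    proof (rule ccontr)
      assume "\<not> ?thesis"
      then have "(\<Sum>i<Suc k. 1) \<le> (\<Sum>i<Suc k. w (int v + 3 * int i))"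
        by (intro sum_mono) (auto simp: less_Suc_eq_le Suc_le_eq)
      then show False using sum by simp
    qed
    then obtain i where i: "i \<le> k" "w (int v + 3 * int i) = 0" by blast
    define z where "z = (int v + 3 * int i) mod int n"
    have n0: "0 < int n" using n by simp
    have shift: "f (x mod int n + d) = f (x + d)" for x d
    proof -
      have "int n dvd x mod int n + d - int u \<longleftrightarrow> int n dvd x + d - int u" for u
      proof -
        have "x + d - int u = (x mod int n + d - int u) + int n * (x div int n)"
          using mod_mult_div_eq[of x "int n"] by linarith
        then show ?thesis by (simp only: dvd_add_left_iff[OF dvd_triv_left])
      qed
      then show ?thesis by (simp add: f_def)
    qed
    have "w z = w (int v + 3 * int i)"
      using shift[of "int v + 3 * int i" 0] shift[of "int v + 3 * int i" 1] shift[of "int v + 3 * int i" 2]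
      unfolding w_def z_def add_0_right by (simp only:)
    then have "w z = 0" using i(2) by simp
    moreover have "0 \<le> z" "z < int n" using n0 by (simp_all add: z_def)
    ultimately have "nat z \<in> Z" by (simp add: Z_def nat_less_iff)
    then have "z \<in> {int z1, int z2}" using \<open>0 \<le> z\<close> unfolding Z by auto
    moreover have "int n dvd int v + 3 * int i - z" by (simp add: z_def)
    ultimately show "\<exists>i\<le>k. \<exists>z\<in>{int z1, int z2}. int n dvd int v + 3 * int i - z" using i(1) by blast
  qed
qed


lemma dvd_reindex:
  fixes m \<kappa> a b :: int
  assumes "m = 3 * \<kappa> + 2"
  shows "m dvd 3 * a - b \<longleftrightarrow> m dvd a - (\<kappa> + 1) * b"
proof
  assume "m dvd 3 * a - b"
  then have "m dvd (\<kappa> + 1) * (3 * a - b) - m * a" by simp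
  also have "(\<kappa> + 1) * (3 * a - b) - m * a = a - (\<kappa> + 1) * b" using assms by (simp add: algebra_simps)
  finally show "m dvd a - (\<kappa> + 1) * b" .
next
  assume "m dvd a - (\<kappa> + 1) * b"
  then have "m dvd 3 * (a - (\<kappa> + 1) * b) + m * b" by (rule dvd_add[OF dvd_mult dvd_triv_left])
  also have "3 * (a - (\<kappa> + 1) * b) + m * b = 3 * a - b" using assms by (simp add: algebra_simps)
  finally show "m dvd 3 * a - b" .
qed

text \<open>In the coordinate \<open>g\<close>, adjacent vertices differ by \<open>k\<close>,
  \<open>k + 1\<close>, \<open>2 k + 1\<close> or \<open>2 k + 2\<close> modulo \<open>n\<close>.
  Two disjoint arcs of \<open>k + 1\<close> points leave \<open>k\<close> points in at most two
  gaps; differences are below \<open>k\<close> within a gap and from \<open>k + 2\<close> to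
  \<open>2 k\<close> across the gaps.\<close>

lemma independent_set_avoiding_arcs:
  fixes k n :: nat and x y :: int
  assumes n: "n = 3 * k + 2" and k: "1 \<le> k"
  defines "g \<equiv> \<lambda>v. (int (k + 1) * int v) mod int n"
  assumes bij: "bij_betw g {1..n} {0..<int n}"
  obtains S where "S \<subseteq> {1..n}" "card S = k" "independent_set {1..n} (sq_cycle_adj n) S"
    "\<And>v j. v \<in> S \<Longrightarrow> g v + j * int n \<notin> {x..x + int k} \<union> {y..y + int k}"
proof -
  define m \<kappa> where "m = int n" and "\<kappa> = int k"
  have m: "m = 3 * \<kappa> + 2" "0 < m" and \<kappa>: "1 \<le> \<kappa>" using n k by (auto simp: m_def \<kappa>_def)
  define d0 where "d0 = (y - x) mod m"
  have d0: "0 \<le> d0" "d0 < m" using m by (auto simp: d0_def)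
  \<comment> \<open>If the arcs overlap, the second is slid until it is just disjoint from the
    first. The new pair covers at least as much and leaves exactly \<open>k\<close> points.\<close>
  define d where "d = (if d0 < \<kappa> + 1 then \<kappa> + 1 else if 2 * \<kappa> + 1 < d0 then 2 * \<kappa> + 1 else d0)"
  have d: "\<kappa> + 1 \<le> d" "d \<le> 2 * \<kappa> + 1" using \<kappa> by (auto simp: d_def)
  define r where "r = (\<lambda>v. (g v - x) mod m)"
  have r: "0 \<le> r v" "r v < m" for v using m by (auto simp: r_def)
  define A where "A = {\<kappa> + 1..<d} \<union> {d + \<kappa> + 1..<m}"
  define S where "S = {v \<in> {1..n}. r v \<in> A}"
  have "bij_betw (\<lambda>u. (u - x) mod m) {0..<m} {0..<m}"
  proof (rule bij_betw_byWitness[of _ "\<lambda>u. (u + x) mod m"])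
    show "\<forall>a\<in>{0..<m}. ((a - x) mod m + x) mod m = a"
      by (simp add: mod_add_left_eq)
    show "\<forall>a\<in>{0..<m}. ((a + x) mod m - x) mod m = a"
      by (simp add: mod_diff_left_eq)
  qed (use m in auto)
  from bij_betw_trans[OF bij[folded m_def] this]
  have bij_r: "bij_betw r {1..n} {0..<m}" by (simp add: r_def comp_def)
  have "r ` S = A"
  proof -
    have "A \<subseteq> {0..<m}" using d \<kappa> m by (auto simp: A_def)
    then have "A \<subseteq> r ` {1..n}" using bij_r by (simp add: bij_betw_def)
    then show ?thesis by (auto simp: S_def)
  qed
  moreover have "inj_on r S" using bij_r by (auto simp: bij_betw_def S_def intro: inj_on_subset)
  ultimately have "card S = card A" by (metis card_image)
  also have "card A = nat (d - (\<kappa> + 1)) + nat (m - (d + \<kappa> + 1))"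
    unfolding A_def using \<kappa> by (subst card_Un_disjoint) auto
  also have "\<dots> = k" using d m by (simp add: \<kappa>_def)
  finally have "card S = k" .
  moreover have "S \<subseteq> {1..n}" by (auto simp: S_def)
  moreover have "independent_set {1..n} (sq_cycle_adj n) S"
    unfolding independent_set_def
  proof (intro conjI ballI notI)
    fix i j assume ij: "i \<in> S" "j \<in> S" and adj: "sq_cycle_adj n i j"
    have "3 \<le> n" "i \<in> {1..n}" "j \<in> {1..n}" using ij \<open>S \<subseteq> {1..n}\<close> n k by auto
    then obtain \<delta> where \<delta>: "\<delta> \<in> {1, 2, -1, -2}" "m dvd int j - int i - \<delta>"
      using sq_cycle_adj_iff[THEN iffD1, OF _ _ _ adj] unfolding m_def by blast
    have rg: "m dvd r v - ((\<kappa> + 1) * int v - x)" for v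
    proof -
      have "r v mod m = ((\<kappa> + 1) * int v - x) mod m"
        by (simp add: r_def g_def m_def \<kappa>_def mod_diff_left_eq add.commute)
      then show ?thesis by (simp only: mod_eq_dvd_iff)
    qed
    have "m dvd (r j - ((\<kappa> + 1) * int j - x)) - (r i - ((\<kappa> + 1) * int i - x)) + (\<kappa> + 1) * (int j - int i - \<delta>)"
      by (rule dvd_add[OF dvd_diff[OF rg rg] dvd_mult[OF \<delta>(2)]])
    also have "(r j - ((\<kappa> + 1) * int j - x)) - (r i - ((\<kappa> + 1) * int i - x)) + (\<kappa> + 1) * (int j - int i - \<delta>)
        = r j - r i - (\<kappa> + 1) * \<delta>" by (simp add: algebra_simps)
    finally obtain q where q: "r j - r i - (\<kappa> + 1) * \<delta> = m * q" by (rule dvdE)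
    have A: "r i \<in> A" "r j \<in> A" using ij by (auto simp: S_def)
    have b: "\<bar>m * q\<bar> < 2 * m"
      using q \<delta>(1) r[of i] r[of j] m \<kappa> by auto
    then have "\<bar>q\<bar> < 2" using m(2) by (simp add: abs_mult)
    then have "q \<in> {-1, 0, 1}" by auto
    then show False
      using q A \<delta>(1) d m(1) \<kappa> unfolding A_def by auto
  qed (use \<open>S \<subseteq> {1..n}\<close> in blast)
  moreover have "g v + j * int n \<notin> {x..x + int k} \<union> {y..y + int k}" if v: "v \<in> S" for v j
  proof
    assume "g v + j * int n \<in> {x..x + int k} \<union> {y..y + int k}"
    moreover have rA: "r v \<in> A" using v by (simp add: S_def)
    moreover have "r v \<in> {0..\<kappa>}" if "g v + j * m \<in> {x..x + \<kappa>}"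
    proof -
      have "r v = (g v + j * m - x) mod m" by (metis r_def add_diff_eq diff_add_eq mod_mult_self1)
      also have "\<dots> = g v + j * m - x" using that m \<kappa> by (intro mod_pos_pos_trivial) auto
      finally show ?thesis using that by auto
    qed
    moreover have "r v \<in> {d0..d0 + \<kappa>} \<or> r v + m \<in> {d0..d0 + \<kappa>}" if "g v + j * m \<in> {y..y + \<kappa>}"
    proof -
      define i where "i = g v + j * m - y"
      have i: "0 \<le> i" "i \<le> \<kappa>" using that by (auto simp: i_def)
      have "r v = (g v + j * m - x) mod m" by (metis r_def add_diff_eq diff_add_eq mod_mult_self1)
      also have "g v + j * m - x = i + (y - x)" by (simp add: i_def)
      also have "(i + (y - x)) mod m = (i + d0) mod m" by (simp add: d0_def mod_add_right_eq)
      also have "\<dots> = (if i + d0 < m then i + d0 else i + d0 - m)"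
        using i d0 m \<kappa> mod_pos_pos_trivial[of "i + d0" m] mod_pos_pos_trivial[of "i + d0 - m" m]
          mod_add_self2[of "i + d0 - m" m] by auto
      finally show ?thesis using i by auto
    qed
    ultimately show False
      using d0 m \<kappa> unfolding A_def d_def m_def[symmetric] \<kappa>_def[symmetric] by (auto split: if_splits)
  qed
  ultimately show thesis using that by blast
qed

lemma total_cut_complex_sq_cycle:
  fixes k n :: nat
  assumes n: "n = 3 * k + 2" and k: "1 \<le> k"
  shows "realize {1..n} (total_cut_complex {1..n} (sq_cycle_adj n) k)
    homotopy_eqv arc_space (int n) (\<lambda>i. i + int k) 0"
  unfolding arc_space_def
proof (rule relabel_homotopy_eqv)
  define m \<kappa> where "m = int n" and "\<kappa> = int k"
  have m: "m = 3 * \<kappa> + 2" "0 < m" using n by (auto simp: m_def \<kappa>_def)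
  define g where "g = (\<lambda>v. (int (k + 1) * int v) mod int n)"
  have g_dvd: "m dvd g v - (\<kappa> + 1) * int v" for v
  proof -
    have "g v mod m = ((\<kappa> + 1) * int v) mod m" by (simp add: g_def m_def \<kappa>_def add.commute)
    then show ?thesis by (simp only: mod_eq_dvd_iff)
  qed
  have unique: "a = b" if "m dvd a - b" "c \<le> a" "a < c + m" "c \<le> b" "b < c + m" for a b c :: int
    using that dvd_imp_le_int[of "a - b" m] by fastforce
  \<comment> \<open>The inverse is multiplication by \<open>3\<close>; subtracting and adding
    \<open>1\<close> moves the residue into \<open>{1..n}\<close>.\<close>
  have bij: "bij_betw g {1..n} {0..<int n}"
  proof (rule bij_betw_byWitness[of _ "\<lambda>u. nat ((3 * u - 1) mod m) + 1"])
    have range: "nat ((3 * u - 1) mod m) + 1 \<in> {1..n}" for u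
      using m pos_mod_bound[OF m(2), of "3 * u - 1"] by (simp add: m_def nat_less_iff Suc_le_eq)
    have h_dvd: "m dvd 3 * u - int (nat ((3 * u - 1) mod m) + 1)" for u
    proof -
      have "3 * u - int (nat ((3 * u - 1) mod m) + 1) = (3 * u - 1) - (3 * u - 1) mod m"
        using m(2) by simp
      then show ?thesis by (simp add: minus_mod_eq_mult_div)
    qed
    show "\<forall>v\<in>{1..n}. nat ((3 * g v - 1) mod m) + 1 = v"
    proof
      fix v assume v: "v \<in> {1..n}"
      have "m dvd 3 * g v - int v" using g_dvd dvd_reindex[OF m(1)] by blast
      then have "m dvd (3 * g v - int v) - (3 * g v - int (nat ((3 * g v - 1) mod m) + 1))"
        using h_dvd dvd_diff by blast
      then have "int (nat ((3 * g v - 1) mod m) + 1) = int v"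
        using v range[of "g v"] by (intro unique[where c = 1]) (auto simp: m_def simp del: of_nat_add)
      then show "nat ((3 * g v - 1) mod m) + 1 = v" by (simp only: of_nat_eq_iff)
    qed
    show "\<forall>u\<in>{0..<int n}. g (nat ((3 * u - 1) mod m) + 1) = u"
    proof
      fix u assume u: "u \<in> {0..<int n}"
      let ?v = "nat ((3 * u - 1) mod m) + 1"
      have "m dvd u - (\<kappa> + 1) * int ?v" using h_dvd[of u] dvd_reindex[OF m(1)] by blast
      then have "m dvd (g ?v - (\<kappa> + 1) * int ?v) - (u - (\<kappa> + 1) * int ?v)"
        using g_dvd dvd_diff by blast
      then have "m dvd g ?v - u" by simp
      then show "g ?v = u" using u m by (intro unique[where c = 0]) (auto simp: m_def g_def)
    qed
    show "g ` {1..n} \<subseteq> {0..<int n}" using m by (auto simp: g_def m_def)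
    show "(\<lambda>u. nat ((3 * u - 1) mod m) + 1) ` {0..<int n} \<subseteq> {1..n}" using range by blast
  qed
  then show "bij_betw g {1..n} {0..<0 + int n}" by simp
  fix s assume s: "s \<subseteq> {1..n}"
  then have gs: "g ` s \<subseteq> {0..<0 + int n}" using bij by (auto simp: bij_betw_def)
  show "g ` s \<in> arc_complex (int n) (\<lambda>i. i + int k) 0 \<longleftrightarrow> s \<in> total_cut_complex {1..n} (sq_cycle_adj n) k"
  proof
    assume "g ` s \<in> arc_complex (int n) (\<lambda>i. i + int k) 0"
    then obtain x y where "\<forall>u\<in>g ` s. \<exists>j. u + j * int n \<in> {x..x + int k} \<union> {y..y + int k}"
      unfolding arc_complex_def by blast
    then have xy: "\<exists>j. g v + j * int n \<in> {x..x + int k} \<union> {y..y + int k}" if "v \<in> s" for v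
      using that by (simp only: ball_simps)
    obtain S where S: "S \<subseteq> {1..n}" "card S = k" "independent_set {1..n} (sq_cycle_adj n) S"
      "\<And>v j. v \<in> S \<Longrightarrow> g v + j * int n \<notin> {x..x + int k} \<union> {y..y + int k}"
      using independent_set_avoiding_arcs[OF n k bij[unfolded g_def], of x y] unfolding g_def by blast
    then have "S \<inter> s = {}" using xy by blast
    then show "s \<in> total_cut_complex {1..n} (sq_cycle_adj n) k"
      using s S(1-3) unfolding total_cut_complex_def by blast
  next
    assume "s \<in> total_cut_complex {1..n} (sq_cycle_adj n) k"
    then have "\<exists>S. S \<subseteq> {1..n} - s \<and> card S = k \<and> independent_set {1..n} (sq_cycle_adj n) S"
      by (simp add: total_cut_complex_def)
    then obtain S where S: "S \<subseteq> {1..n} - s" "card S = k" "independent_set {1..n} (sq_cycle_adj n) S"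
      by (elim exE conjE)
    then have "S \<subseteq> {1..n}" by blast
    then obtain z1 z2 where z: "\<And>v. v \<in> {1..n} - S \<Longrightarrow> \<exists>i\<le>k. \<exists>z\<in>{z1, z2}. int n dvd int v + 3 * int i - z"
      using independent_set_empty_windows[OF n k _ S(2,3)] by blast
    \<comment> \<open>An empty window at \<open>z\<close> becomes the arc of \<open>k + 1\<close>
      points ending at \<open>(\<kappa> + 1) * z\<close>: if \<open>v + 3 i\<close> is congruent to
      \<open>z\<close>, then \<open>g v\<close> is congruent to
      \<open>(\<kappa> + 1) * z - i\<close>, with \<open>i \<le> k\<close>.\<close>
    show "g ` s \<in> arc_complex (int n) (\<lambda>i. i + int k) 0"
    proof (rule arc_complexI[OF gs, of "(\<kappa> + 1) * z1 - \<kappa>" _ "(\<kappa> + 1) * z2 - \<kappa>"])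
      fix u assume "u \<in> g ` s"
      then obtain v where v: "v \<in> s" "u = g v" by blast
      then have "v \<in> {1..n} - S" using s S(1) by blast
      then obtain i zz where iz: "i \<le> k" "zz \<in> {z1, z2}" "m dvd int v + 3 * int i - zz"
        using z unfolding m_def by blast
      have "m dvd (g v - (\<kappa> + 1) * int v) + (\<kappa> + 1) * (int v + 3 * int i - zz) - m * int i"
        by (rule dvd_diff[OF dvd_add[OF g_dvd dvd_mult[OF iz(3)]] dvd_triv_left])
      also have "(g v - (\<kappa> + 1) * int v) + (\<kappa> + 1) * (int v + 3 * int i - zz) - m * int i = g v - ((\<kappa> + 1) * zz - int i)"
        using m(1) by (simp add: algebra_simps)
      finally obtain q where "g v - ((\<kappa> + 1) * zz - int i) = m * q" by (rule dvdE)
      then have "u + (- q) * int n = (\<kappa> + 1) * zz - int i" using v(2) by (simp add: m_def algebra_simps)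
      then have "u + (- q) * int n \<in> {(\<kappa> + 1) * zz - \<kappa>..(\<kappa> + 1) * zz - \<kappa> + int k}"
        using iz(1) by (simp add: \<kappa>_def)
      then show "\<exists>j. u + j * int n \<in> {(\<kappa> + 1) * z1 - \<kappa>..(\<kappa> + 1) * z1 - \<kappa> + int k}
          \<union> {(\<kappa> + 1) * z2 - \<kappa>..(\<kappa> + 1) * z2 - \<kappa> + int k}"
        using iz(2) by blast
    qed
  qed
qed (auto simp: total_cut_complex_def arc_complex_def)

section \<open>The homotopy type\<close>

lemma arc_space_7_nsphere: "arc_space 7 (\<lambda>i. i + 2) 0 homotopy_eqv {x :: nat \<Rightarrow> real. (\<Sum>i\<le>5. (x i)\<^sup>2) = 1 \<and> (\<forall>i>5. x i = 0)}"
proof -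
  have "realize {..6::nat} {s. s \<subset> {..6}} homotopy_eqv arc_space 7 (\<lambda>i. i + 2) 0"
    unfolding arc_space_def arc_complex_7
  proof (rule relabel_homotopy_eqv[where g = int])
    have img: "int ` {..6} = {0..<7}"
    proof (intro equalityI subsetI)
      fix x :: int assume "x \<in> {0..<7}"
      then show "x \<in> int ` {..6}" by (intro image_eqI[of _ _ "nat x"]) auto
    qed auto
    then show "bij_betw int {..6} {0..<0 + 7}" by (simp add: bij_betw_def)
    show "int ` s \<in> {s. s \<subset> {0..<7}} \<longleftrightarrow> s \<in> {s. s \<subset> {..6}}" for s
      unfolding img[symmetric] by (auto simp: psubset_eq inj_image_subset_iff inj_image_eq_iff)
  qed auto
  moreover have "realize {..6::nat} {s. s \<subset> {..6}} homotopy_eqv {x :: nat \<Rightarrow> real. (\<Sum>i\<le>5. (x i)\<^sup>2) = 1 \<and> (\<forall>i>5. x i = 0)}"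
    using realize_simplex_boundary_nsphere[of 5] by simp
  ultimately show ?thesis
    using homotopy_eqv_trans homotopy_equivalent_space_sym by blast
qed

theorem theorem4p3:
  fixes k :: nat
  assumes "k \<ge> 3"
  shows "geom_realization {1..3*k+2}
           (total_cut_complex {1..3*k+2} (sq_cycle_adj (3*k+2)) k)
         homotopy_equivalent_space nsphere 5"
proof -
  let ?N = "3 * int k + 5"
  have "int k * ?N \<le> (int k + 1) * int (3 * k + 2)" by (simp add: algebra_simps)
  then have 1: "arc_space ?N (\<lambda>i. i + (int k + 1)) 0 homotopy_eqv arc_space (int (3 * k + 2)) (\<lambda>i. i + int k) 0"
    using assms by (intro arc_space_uniform_rescale) auto
  \<comment> \<open>The scale condition reads \<open>2 * (3 k + 5) \<le> 7 * (k + 1)\<close>, an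
    equality at \<open>k = 3\<close>.\<close>
  have 2: "arc_space ?N (\<lambda>i. i + (int k + 1)) 0 homotopy_eqv arc_space 7 (\<lambda>i. i + 2) 0"
    using assms by (intro arc_space_uniform_rescale) auto
  have "realize {1..3*k+2} (total_cut_complex {1..3*k+2} (sq_cycle_adj (3*k+2)) k)
      homotopy_eqv arc_space (int (3 * k + 2)) (\<lambda>i. i + int k) 0"
    using assms by (intro total_cut_complex_sq_cycle) auto
  also note 1[THEN homotopy_equivalent_space_sym[THEN iffD1]]
  also note 2
  also note arc_space_7_nsphere
  finally show ?thesis unfolding geom_realization_eq nsphere_eq .
qed

end
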